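(* Let $N$ be a nonnegative integer and let $t,b,d_1,d_2,e,\sigma,\beta,\delta_1,\delta_2,\phi$ be nonzero complex numbers, generic in the sense that no denominator below vanishes, such that $$t^2\sigma^2q^{N+2}=b\,d_1d_2\,e\,\beta\delta_1\delta_2\phi .$$ Then $$\sum_{K=0}^{N}\frac{(b/t,\ d_1/t,\ d_2/t,\ \sigma q,\ \phi,\ q^{-N})_K}{(q,\ 1/t,\ q/e,\ \sigma q/\beta,\ \sigma q/\delta_1,\ \sigma q/\delta_2)_K}\,q^K$$ $$\times\ {}_{8}W_7\left[tq^{-K};\,b,d_1,d_2,eq^{-K},q^{-K};\,q;\,\frac{t^2q^2}{bd_1d_2e}\right]\ {}_{8}W_7\left[\sigma q^K;\,\beta,\delta_1,\delta_2,\phi q^K,q^{K-N};\,q;\,\frac{\sigma^2q^{N+2}}{\beta\delta_1\delta_2\phi}\right]$$ $$=\phi^N\,\frac{(\sigma q,\ \sigma q/(\beta\phi),\ \sigma q/(\delta_1\phi),\ \sigma q/(\delta_2\phi))_N}{(\sigma q/\beta,\ \sigma q/\phi,\ \sigma q/\delta_1,\ \sigma q/\delta_2)_N}$$ $$\times\ {}_6\phi_5\left[\begin{matrix}tq/(be),\ tq/(d_1e),\ tq/(d_2e),\ q^{-N}\phi/\sigma,\ \phi,\ q^{-N}\\ tq/e,\ q/e,\ q^{-N}\beta\phi/\sigma,\ q^{-N}\delta_1\phi/\sigma,\ q^{-N}\delta_2\phi/\sigma\end{matrix};q;q\right].$$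
   Context: Fix a complex number $q$ with $0<|q|<1$. For $k\in\mathbb N=\{0,1,2,\dots\}$, $(a)_k=(a;q)_k=\prod_{i=0}^{k-1}(1-aq^i)$, and $(a_1,\dots,a_r)_k=(a_1)_k\cdots(a_r)_k$. The basic hypergeometric series is $${}_{n+1}\phi_n\left[\begin{matrix}a_0,a_1,\dots,a_n\\ c_1,\dots,c_n\end{matrix};q;u\right]=\sum_{k\in\mathbb N}\frac{(a_0,a_1,\dots,a_n)_k}{(q,c_1,\dots,c_n)_k}u^k,$$ and the very well-poised basic hypergeometric series is $${}_{n+1}W_n[a_0;a_3,\dots,a_n;q;u]=\sum_{k\in\mathbb N}\frac{1-a_0q^{2k}}{1-a_0}\,\frac{(a_0)_k(a_3)_k\cdots(a_n)_k}{(q)_k(a_0q/a_3)_k\cdots(a_0q/a_n)_k}\,u^k .$$ All series in the claim terminate: when the last listed (numerator) parameter is $q^{-M}$ with $M$ a nonnegative integer, the series is read as the finite sum over $0\le k\le M$. *)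

theory Defs
  imports Complex_Main
begin

definition qpoch :: "complex \<Rightarrow> complex \<Rightarrow> nat \<Rightarrow> complex" where
  "qpoch a q k = (\<Prod>i<k. 1 - a * q ^ i)"

definition qpochs :: "complex list \<Rightarrow> complex \<Rightarrow> nat \<Rightarrow> complex" where
  "qpochs as q k = (\<Prod>a\<leftarrow>as. qpoch a q k)"

definition phi_denom :: "complex list \<Rightarrow> complex \<Rightarrow> nat \<Rightarrow> complex" where
  "phi_denom cs q k = qpochs (q # cs) q k"

text \<open>\<open>basic_phi [a\<^sub>0,\<dots>,a\<^sub>n] [c\<^sub>1,\<dots>,c\<^sub>n] q u\<close>.\<close>
definition basic_phi :: "complex list \<Rightarrow> complex list \<Rightarrow> complex \<Rightarrow> complex \<Rightarrow> complex" where
  "basic_phi as cs q u = (\<Sum>k. qpochs as q k / phi_denom cs q k * u ^ k)"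

definition W_denom :: "complex \<Rightarrow> complex list \<Rightarrow> complex \<Rightarrow> nat \<Rightarrow> complex" where
  "W_denom a0 as q k = (1 - a0) * qpochs (q # map (\<lambda>a. a0 * q / a) as) q k"

text \<open>\<open>basic_W a\<^sub>0 [a\<^sub>3,\<dots>,a\<^sub>n] q u\<close>.\<close>
definition basic_W :: "complex \<Rightarrow> complex list \<Rightarrow> complex \<Rightarrow> complex \<Rightarrow> complex" where
  "basic_W a0 as q u =
     (\<Sum>k. ((1 - a0 * q ^ (2 * k)) * qpochs (a0 # as) q k) / W_denom a0 as q k * u ^ k)"

text \<open>
  When some numerator parameter is \<open>q\<^sup>-\<^sup>M\<close>, all numerators with \<open>k > M\<close> vanish; since
  \<open>0 / x = 0\<close> in HOL for every \<open>x\<close> (including \<open>x = 0\<close>), the series above then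
  are the finite sums over \<open>k \<le> M\<close>, whatever happens to the denominators with \<open>k > M\<close>.
\<close>

lemma qpoch_terminates:
  assumes "q \<noteq> 0" and "M < k"
  shows "qpoch (q powi (- int M)) q k = 0"
proof -
  have "1 - q powi (- int M) * q ^ M = 0"
    using assms(1) by (simp add: power_int_minus)
  with assms(2) show ?thesis
    unfolding qpoch_def by (intro prod_zero) auto
qed

lemma qpochs_terminates:
  assumes "q \<noteq> 0" and "q powi (- int M) \<in> set as" and "M < k"
  shows "qpochs as q k = 0"
  using assms qpoch_terminates[OF assms(1,3)] unfolding qpochs_def
  by (auto simp: prod_list_zero_iff image_iff intro!: bexI)

lemma basic_phi_terminating:
  assumes "q \<noteq> 0" and "q powi (- int M) \<in> set as"
  shows "basic_phi as cs q u = (\<Sum>k\<le>M. qpochs as q k / phi_denom cs q k * u ^ k)"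
  unfolding basic_phi_def
  by (rule suminf_finite) (use qpochs_terminates[OF assms] in auto)

lemma basic_W_terminating:
  assumes "q \<noteq> 0" and "q powi (- int M) \<in> set as"
  shows "basic_W a0 as q u =
    (\<Sum>k\<le>M. ((1 - a0 * q ^ (2 * k)) * qpochs (a0 # as) q k) / W_denom a0 as q k * u ^ k)"
proof -
  have "q powi (- int M) \<in> set (a0 # as)"
    using assms(2) by simp
  then show ?thesis
    unfolding basic_W_def
    by (intro suminf_finite) (use qpochs_terminates[OF assms(1)] in auto)
qed

end

theory Submission
  imports Defs "HOL-Computational_Algebra.Polynomial" "HOL-Computational_Algebra.Formal_Power_Series"
begin

text \<open>
  The left-hand side is a coefficient of a product of two power series, and both factors simplify.

  Write \<open>c = q / e\<close> and \<open>C = b d1 d2 / (c t\<^sup>2)\<close>. In the first \<open>\<^sub>8W\<^sub>7\<close>, a reversal of the products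
  with argument depending on \<open>q\<^sup>-\<^sup>K\<close> turns the series, together with the factors
  \<open>(b/t, d1/t, d2/t)\<^sub>K / (q, 1/t, q/e)\<^sub>K\<close>, into a sum over \<open>k + l = K\<close> that treats the two points
  \<open>t q\<^sup>k\<close> and \<open>q\<^sup>l\<close> alike (\<open>W_conversion\<close>). Such a two-point sum equals
  \<open>\<Sum>j\<le>K. \<alpha>\<^sub>j C\<^sup>j (C)\<^bsub>K-j\<^esub> / (q)\<^bsub>K-j\<^esub>\<close> with
  \<open>\<alpha>\<^sub>j = (ct/b, ct/d1, ct/d2)\<^sub>j / (q, ct, c)\<^sub>j\<close> (\<open>two_point_transformation\<close>, an Euler-type
  transformation of Kajihara between two-dimensional and one-dimensional series). Its generating
  function is thus \<open>(Cu)\<^sub>\<infinity> / (u)\<^sub>\<infinity>\<close> times that of \<open>\<alpha>\<^sub>j C\<^sup>j\<close>.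

  The second \<open>\<^sub>8W\<^sub>7\<close> has the same form with \<open>K, t, b, d1, d2, e\<close> replaced by \<open>N - K\<close>, \<open>\<sigma> q\<^sup>N\<close>, \<open>\<beta>\<close>,
  \<open>\<delta>1\<close>, \<open>\<delta>2\<close>, \<open>\<phi> q\<^sup>N\<close>; it yields \<open>\<alpha>'\<close> and \<open>C'\<close>. The balancing condition says precisely that
  \<open>C C' = 1\<close>. The two quotients of infinite products then cancel in the convolution over \<open>K\<close>,
  by the \<open>q\<close>-Vandermonde sum, and only \<open>\<Sum>j\<le>N. \<alpha>\<^sub>j \<alpha>'\<^bsub>N-j\<^esub> C'\<^bsup>N-j\<^esup>\<close> remains
  (\<open>convolution\<close>). Reversing \<open>\<alpha>'\<close> gives the \<open>\<^sub>6\<phi>\<^sub>5\<close> (\<open>coefficient_reverse\<close>, \<open>prefactor_reverse\<close>).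

  The transformation itself is proved by interpolation. Both sides are polynomials of degree at most
  \<open>n\<close> in \<open>b\<close>. At \<open>b = c t\<close> it reduces to a summation formula (\<open>two_point_Vandermonde\<close>), and a contiguous
  relation satisfied by both sides carries it to \<open>b = c t q\<^sup>M\<close> for \<open>M \<le> n\<close>.
\<close>

section \<open>Shifted factorials\<close>

lemma qpoch_0 [simp]: "qpoch a q 0 = 1"
  by (simp add: qpoch_def)

lemma qpoch_Suc: "qpoch a q (Suc k) = qpoch a q k * (1 - a * q ^ k)"
  by (simp add: qpoch_def)

lemma qpoch_Suc_shift: "qpoch a q (Suc k) = (1 - a) * qpoch (a * q) q k"
  by (induction k) (simp_all add: qpoch_Suc ac_simps)

lemma qpoch_shift: "(1 - x) * qpoch (x * q) q k = (1 - x * q ^ k) * qpoch x q k"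
  using qpoch_Suc_shift[of x q k] qpoch_Suc[of x q k] by (simp add: ac_simps)

lemma qpoch_add: "qpoch a q (m + n) = qpoch a q m * qpoch (a * q ^ m) q n"
  by (induction n) (simp_all add: qpoch_Suc power_add ac_simps)

lemma qpoch_split: "k \<le> n \<Longrightarrow> qpoch a q n = qpoch a q k * qpoch (a * q ^ k) q (n - k)"
  using qpoch_add[of a q k "n - k"] by simp

lemma qpoch_nonzero_le: "qpoch a q n \<noteq> 0 \<Longrightarrow> k \<le> n \<Longrightarrow> qpoch a q k \<noteq> 0"
  using qpoch_split[of k n a q] by auto

lemma qpoch_nonzero_factor: "qpoch a q n \<noteq> 0 \<Longrightarrow> k < n \<Longrightarrow> 1 - a * q ^ k \<noteq> 0"
  using qpoch_nonzero_le[of a q n "Suc k"] by (auto simp: qpoch_Suc)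

text \<open>
Both Vandermonde-type sums below are evaluated by splitting \<open>1 - q\<^sup>n\<^sup>+\<^sup>1\<close> times each term on the
antidiagonal \<open>k + l = n + 1\<close> into a part divisible by \<open>1 - q\<^sup>l\<close> and a part divisible by \<open>1 - q\<^sup>k\<close>; the two parts are
moved to the antidiagonal \<open>k + l = n\<close> along different axes.
\<close>

lemma antidiagonal_shift:
  fixes A B :: "nat \<Rightarrow> nat \<Rightarrow> 'a::comm_monoid_add"
  assumes "A (Suc n) 0 = 0" "B 0 (Suc n) = 0"
  shows "(\<Sum>k\<le>Suc n. A k (Suc n - k) + B k (Suc n - k)) =
         (\<Sum>k\<le>n. A k (Suc (n - k)) + B (Suc k) (n - k))"
proof -
  have "(\<Sum>k\<le>Suc n. A k (Suc n - k)) = (\<Sum>k\<le>n. A k (Suc (n - k)))"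
    using assms(1) by (auto simp: Suc_diff_le intro!: sum.cong)
  moreover have "(\<Sum>k\<le>Suc n. B k (Suc n - k)) = (\<Sum>k\<le>n. B (Suc k) (n - k))"
    using assms(2) by (simp only: sum.atMost_Suc_shift) simp
  ultimately show ?thesis by (simp add: sum.distrib)
qed

locale q_base =
  fixes q :: complex
  assumes q_nonzero: "q \<noteq> 0"
    and q_power_neq_1: "0 < n \<Longrightarrow> q ^ n \<noteq> 1"
begin

abbreviation P :: "complex \<Rightarrow> nat \<Rightarrow> complex"
  where "P a k \<equiv> qpoch a q k"

lemma P_q_nonzero: "P q k \<noteq> 0"
  using q_power_neq_1[of "Suc _"] by (induction k) (auto simp: qpoch_Suc)

lemma one_minus_power_nonzero: "1 - q ^ Suc k \<noteq> 0"
  using q_power_neq_1[of "Suc k"] by auto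

section \<open>Two Vandermonde-type sums\<close>

text \<open>
The splitting is \<open>1 - q\<^sup>m\<^sup>+\<^sup>l = (1 - q\<^sup>l) + q\<^sup>l (1 - q\<^sup>m)\<close>.
\<close>

lemma q_Vandermonde:
  "(\<Sum>m\<le>n. b ^ m * (P a m * P b (n - m)) / (P q m * P q (n - m))) = P (a * b) n / P q n"
proof (induction n)
  case 0
  then show ?case by simp
next
  case (Suc n)
  define g where "g m l = b ^ m * (P a m * P b l) / (P q m * P q l)" for m l
  have gl: "(1 - q ^ Suc l) * g m (Suc l) = (1 - b * q ^ l) * g m l" for m l
    using P_q_nonzero one_minus_power_nonzero[of l]
    by (simp add: g_def qpoch_Suc field_simps)
  have gm: "(1 - q ^ Suc m) * g (Suc m) l = b * (1 - a * q ^ m) * g m l" for m l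
    using P_q_nonzero one_minus_power_nonzero[of m]
    by (simp add: g_def qpoch_Suc field_simps)
  have "(1 - q ^ Suc n) * (\<Sum>m\<le>Suc n. g m (Suc n - m)) =
      (\<Sum>m\<le>Suc n. (1 - q ^ (Suc n - m)) * g m (Suc n - m)
        + q ^ (Suc n - m) * ((1 - q ^ m) * g m (Suc n - m)))"
    unfolding sum_distrib_left
  proof (intro sum.cong refl)
    fix m assume "m \<in> {..Suc n}"
    then have "q ^ Suc n = q ^ (Suc n - m) * q ^ m"
      by (simp flip: power_add)
    then show "(1 - q ^ Suc n) * g m (Suc n - m) = (1 - q ^ (Suc n - m)) * g m (Suc n - m)
        + q ^ (Suc n - m) * ((1 - q ^ m) * g m (Suc n - m))"
      by (simp add: algebra_simps)
  qed
  also have "\<dots> = (\<Sum>m\<le>n. (1 - q ^ Suc (n - m)) * g m (Suc (n - m))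
        + q ^ (n - m) * ((1 - q ^ Suc m) * g (Suc m) (n - m)))"
    by (rule antidiagonal_shift) auto
  also have "\<dots> = (\<Sum>m\<le>n. (1 - a * b * q ^ n) * g m (n - m))"
  proof (intro sum.cong refl)
    fix m assume "m \<in> {..n}"
    then have *: "q ^ n = q ^ (n - m) * q ^ m"
      by (simp flip: power_add)
    show "(1 - q ^ Suc (n - m)) * g m (Suc (n - m))
        + q ^ (n - m) * ((1 - q ^ Suc m) * g (Suc m) (n - m)) = (1 - a * b * q ^ n) * g m (n - m)"
      unfolding gl gm * by (simp add: algebra_simps)
  qed
  also have "\<dots> = (1 - a * b * q ^ n) * (P (a * b) n / P q n)"
    unfolding sum_distrib_left[symmetric] using Suc by (simp add: g_def)
  finally have "(1 - q ^ Suc n) * (\<Sum>m\<le>Suc n. g m (Suc n - m)) =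
      (1 - a * b * q ^ n) * (P (a * b) n / P q n)" .
  then have "(\<Sum>m\<le>Suc n. g m (Suc n - m)) = P (a * b) (Suc n) / P q (Suc n)"
    using one_minus_power_nonzero[of n] P_q_nonzero[of n]
    by (simp add: qpoch_Suc field_simps)
  then show ?case unfolding g_def .
qed

text \<open>
The two-point sums have a pair of points \<open>(t, 1)\<close>, of which the first is displaced by \<open>q\<^sup>k\<close> and the
second by \<open>q\<^sup>l\<close>. A parameter \<open>x\<close> contributes \<open>(x)\<^sub>k\<close> and \<open>(x/t)\<^sub>l\<close>. The factor \<open>(t q\<^sup>k - q\<^sup>l) / (t - 1)\<close> of the
weight is the quotient of Vandermonde determinants of the displaced and the original points.
\<close>

definition qpoch2 :: "complex \<Rightarrow> complex \<Rightarrow> nat \<Rightarrow> nat \<Rightarrow> complex"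
  where "qpoch2 t x k l = P x k * P (x / t) l"

definition weight :: "complex \<Rightarrow> nat \<Rightarrow> nat \<Rightarrow> complex"
  where "weight t k l = (t * q ^ k - q ^ l) / ((t - 1) * (qpoch2 t q k l * qpoch2 t (q * t) k l))"

lemma qpoch2_Suc_left: "qpoch2 t x (Suc k) l = (1 - x * q ^ k) * qpoch2 t x k l"
  by (simp add: qpoch2_def qpoch_Suc)

lemma qpoch2_Suc_right: "qpoch2 t x k (Suc l) = (1 - x / t * q ^ l) * qpoch2 t x k l"
  by (simp add: qpoch2_def qpoch_Suc)

lemma qpoch2_shift:
  "(1 - x) * (1 - x / t) * qpoch2 t (x * q) k l = (1 - x * q ^ k) * (1 - x / t * q ^ l) * qpoch2 t x k l"
proof -
  have "(1 - x) * (1 - x / t) * qpoch2 t (x * q) k l =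
      ((1 - x) * P (x * q) k) * ((1 - x / t) * P (x / t * q) l)"
    by (simp add: qpoch2_def)
  then show ?thesis
    by (simp only: qpoch_shift) (simp add: qpoch2_def)
qed

definition weight_regular :: "complex \<Rightarrow> nat \<Rightarrow> bool"
  where "weight_regular t n \<longleftrightarrow> t \<noteq> 0 \<and> t \<noteq> 1 \<and> P (q * t) n \<noteq> 0 \<and> P (q / t) n \<noteq> 0"

lemma weight_regular_le: "weight_regular t n \<Longrightarrow> m \<le> n \<Longrightarrow> weight_regular t m"
  unfolding weight_regular_def using qpoch_nonzero_le by blast

text \<open>
The two-dimensional Milne-type analogue of the \<open>q\<close>-Vandermonde sum, equivalent to the terminating \<open>\<^sub>6W\<^sub>5\<close> sum.
With \<open>x = q\<^sup>k\<close> and \<open>z = q\<^sup>l\<close> it rests on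
\<open>(1 - x z) (t x - z) = x (1 - z) (t - z) - z (1 - x) (1 - t x)\<close>:
the factors on the right cancel the last factors of the denominators.
\<close>

lemma two_point_Vandermonde:
  assumes "weight_regular t n"
  shows "(\<Sum>k\<le>n. weight t k (n - k) * (qpoch2 t b k (n - k) * qpoch2 t d k (n - k))) = P (b * d / t) n / P q n"
  using assms
proof (induction n)
  case 0
  then show ?case by (simp add: weight_def qpoch2_def weight_regular_def)
next
  case (Suc n)
  then have t: "t \<noteq> 0" "t \<noteq> 1" by (auto simp: weight_regular_def)
  define g where "g k l = qpoch2 t b k l * qpoch2 t d k l / (qpoch2 t q k l * qpoch2 t (q * t) k l)" for k l
  have ex: "1 - q * q ^ k \<noteq> 0" "1 - q * t * q ^ k \<noteq> 0" "1 - q / t * q ^ k \<noteq> 0" if "k \<le> n" for k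
    using one_minus_power_nonzero[of k] Suc.prems that
      qpoch_nonzero_factor[of "q * t" q "Suc n" k] qpoch_nonzero_factor[of "q / t" q "Suc n" k]
    unfolding weight_regular_def by simp_all
  have gl: "(1 - q ^ Suc l) * (t - q ^ Suc l) * g k (Suc l) = t * (1 - b / t * q ^ l) * (1 - d / t * q ^ l) * g k l"
    if "l \<le> n" for k l
  proof -
    have "g k (Suc l) = (1 - b / t * q ^ l) * (1 - d / t * q ^ l) / ((1 - q / t * q ^ l) * (1 - q * q ^ l)) * g k l"
      using t by (simp add: g_def qpoch2_Suc_right ac_simps)
    moreover have "(1 - q ^ Suc l) * (t - q ^ Suc l) = t * ((1 - q / t * q ^ l) * (1 - q * q ^ l))"
      using t by (simp add: field_simps)
    ultimately show ?thesis using ex[OF that] t by simp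
  qed
  have gk: "(1 - q ^ Suc k) * (1 - t * q ^ Suc k) * g (Suc k) l = (1 - b * q ^ k) * (1 - d * q ^ k) * g k l"
    if "k \<le> n" for k l
  proof -
    have "g (Suc k) l = (1 - b * q ^ k) * (1 - d * q ^ k) / ((1 - q * q ^ k) * (1 - q * t * q ^ k)) * g k l"
      using t by (simp add: g_def qpoch2_Suc_left ac_simps)
    moreover have prod: "(1 - q ^ Suc k) * (1 - t * q ^ Suc k) = ((1 - q * q ^ k) * (1 - q * t * q ^ k))"
      by (simp add: ac_simps)
    ultimately show ?thesis unfolding prod using ex[OF that] t by simp
  qed
  have split: "(1 - z * x) * ((t * x - z) * G) = x * ((1 - z) * (t - z) * G) + - (z * ((1 - x) * (1 - t * x) * G))"
    for x z G by (simp add: algebra_simps)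
  let ?A = "\<lambda>k l. q ^ k * ((1 - q ^ l) * (t - q ^ l) * g k l)"
  let ?B = "\<lambda>k l. - (q ^ l * ((1 - q ^ k) * (1 - t * q ^ k) * g k l))"
  have "(1 - q ^ Suc n) * (\<Sum>k\<le>Suc n. (t * q ^ k - q ^ (Suc n - k)) * g k (Suc n - k)) =
      (\<Sum>k\<le>Suc n. ?A k (Suc n - k) + ?B k (Suc n - k))"
    unfolding sum_distrib_left
  proof (intro sum.cong refl)
    fix k assume "k \<in> {..Suc n}"
    then have "q ^ Suc n = q ^ (Suc n - k) * q ^ k"
      by (simp flip: power_add)
    then show "(1 - q ^ Suc n) * ((t * q ^ k - q ^ (Suc n - k)) * g k (Suc n - k)) =
        ?A k (Suc n - k) + ?B k (Suc n - k)"
      by (simp only: split)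
  qed
  also have "\<dots> = (\<Sum>k\<le>n. ?A k (Suc (n - k)) + ?B (Suc k) (n - k))"
    by (rule antidiagonal_shift) auto
  also have "\<dots> = (\<Sum>k\<le>n. (1 - b * d / t * q ^ n) * ((t * q ^ k - q ^ (n - k)) * g k (n - k)))"
  proof (intro sum.cong refl)
    fix k assume k: "k \<in> {..n}"
    then have *: "q ^ n = q ^ (n - k) * q ^ k"
      by (simp flip: power_add)
    have "?A k (Suc (n - k)) + ?B (Suc k) (n - k) =
       q ^ k * (t * (1 - b / t * q ^ (n - k)) * (1 - d / t * q ^ (n - k)) * g k (n - k))
       - q ^ (n - k) * ((1 - b * q ^ k) * (1 - d * q ^ k) * g k (n - k))"
      using k by (subst gl gk, simp)+ simp
    also have "\<dots> = (1 - b * d / t * q ^ n) * ((t * q ^ k - q ^ (n - k)) * g k (n - k))"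
      unfolding * using t by (simp add: field_simps)
    finally show "?A k (Suc (n - k)) + ?B (Suc k) (n - k) =
       (1 - b * d / t * q ^ n) * ((t * q ^ k - q ^ (n - k)) * g k (n - k))" .
  qed
  also have "\<dots> = (1 - b * d / t * q ^ n) * ((t - 1) * (P (b * d / t) n / P q n))"
  proof -
    have "(\<Sum>k\<le>n. (t * q ^ k - q ^ (n - k)) * g k (n - k)) = 
       (t - 1) * (\<Sum>k\<le>n. weight t k (n - k) * (qpoch2 t b k (n - k) * qpoch2 t d k (n - k)))"
      using t by (simp add: g_def weight_def sum_distrib_left)
    also have "\<dots> = (t - 1) * (P (b * d / t) n / P q n)"
      using Suc.IH[OF weight_regular_le[OF Suc.prems]] by simp
    finally show ?thesis unfolding sum_distrib_left[symmetric] by simp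
  qed
  finally have "(\<Sum>k\<le>Suc n. (t * q ^ k - q ^ (Suc n - k)) * g k (Suc n - k)) =
      (1 - b * d / t * q ^ n) * ((t - 1) * (P (b * d / t) n / P q n)) / (1 - q ^ Suc n)"
    by (intro eq_divide_imp[OF one_minus_power_nonzero]) (subst mult.commute)
  then have "(\<Sum>k\<le>Suc n. (t * q ^ k - q ^ (Suc n - k)) * g k (Suc n - k)) =
      (t - 1) * (P (b * d / t) (Suc n) / P q (Suc n))"
    by (simp add: qpoch_Suc ac_simps)
  moreover have "(\<Sum>k\<le>Suc n. (t * q ^ k - q ^ (Suc n - k)) * g k (Suc n - k)) =
     (t - 1) * (\<Sum>k\<le>Suc n. weight t k (Suc n - k) * (qpoch2 t b k (Suc n - k) * qpoch2 t d k (Suc n - k)))"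
    unfolding sum_distrib_left using t by (intro sum.cong) (simp_all add: g_def weight_def)
  ultimately have "(t - 1) * (\<Sum>k\<le>Suc n. weight t k (Suc n - k) * (qpoch2 t b k (Suc n - k) * qpoch2 t d k (Suc n - k))) =
      (t - 1) * (P (b * d / t) (Suc n) / P q (Suc n))"
    by (simp only:)
  then show ?case
    by (rule mult_left_cancel[THEN iffD1, rotated]) (use t in simp)
qed

section \<open>Contiguous relations\<close>

definition two_point_sum :: "complex \<Rightarrow> complex \<Rightarrow> complex \<Rightarrow> complex \<Rightarrow> complex \<Rightarrow> nat \<Rightarrow> complex"
  where "two_point_sum t y b d d' n =
    (\<Sum>k\<le>n. weight t k (n - k) *
       (qpoch2 t b k (n - k) * qpoch2 t d k (n - k) * qpoch2 t d' k (n - k) / qpoch2 t y k (n - k)))"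

text \<open>
Raising the parameter \<open>x\<close> to \<open>x q\<close> multiplies a term by a linear function of \<open>t q\<^sup>k + q\<^sup>l\<close>, since
\<open>t q\<^sup>k q\<^sup>l = t q\<^sup>n\<close> is constant on the antidiagonal. The three functions arising from raising \<open>b\<close>, raising \<open>d\<close>
and raising nothing lie in a space of dimension two, so they are linearly dependent, term by term.
\<close>

lemma two_point_sum_contiguous:
  assumes "t \<noteq> 0"
  shows "d * (1 - b) * (1 - b / t) * two_point_sum t y (b * q) d d' n - b * (1 - d) * (1 - d / t) * two_point_sum t y b (d * q) d' n
     = (d - b) * (1 - b * d * q ^ n / t) * two_point_sum t y b d d' n"
proof -
  have "d * ((1 - b) * (1 - b / t) * qpoch2 t (b * q) k l) * qpoch2 t d k l
          - b * qpoch2 t b k l * ((1 - d) * (1 - d / t) * qpoch2 t (d * q) k l)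
        = (d - b) * (1 - b * d * q ^ n / t) * (qpoch2 t b k l * qpoch2 t d k l)"
    if "k + l = n" for k l
  proof -
    have "q ^ n = q ^ k * q ^ l"
      using that by (simp flip: power_add)
    then show ?thesis
      unfolding qpoch2_shift using assms by (simp add: field_simps)
  qed
  then have *: "(d * ((1 - b) * (1 - b / t) * qpoch2 t (b * q) k l) * qpoch2 t d k l
          - b * qpoch2 t b k l * ((1 - d) * (1 - d / t) * qpoch2 t (d * q) k l)) * (weight t k l * qpoch2 t d' k l / qpoch2 t y k l)
        = (d - b) * (1 - b * d * q ^ n / t) * (qpoch2 t b k l * qpoch2 t d k l) * (weight t k l * qpoch2 t d' k l / qpoch2 t y k l)"
    if "k + l = n" for k l
    using that by simp
  show ?thesis
    unfolding two_point_sum_def sum_distrib_left sum_subtractf[symmetric]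
  proof (intro sum.cong refl, goal_cases)
    case (1 k)
    then have "k + (n - k) = n" by simp
    from *[OF this] show ?case
      by (simp add: algebra_simps diff_divide_distrib add_divide_distrib)
  qed
qed

text \<open>
Up to the factor \<open>(C)\<^sub>n / (q)\<^sub>n\<close>, where \<open>C = b d d' / (t y)\<close>, the sum of these terms is a terminating
balanced \<open>\<^sub>4\<phi>\<^sub>3\<close>; the present form has no denominator that depends on \<open>C\<close>.
\<close>

definition balanced_term :: "complex \<Rightarrow> complex \<Rightarrow> complex \<Rightarrow> complex \<Rightarrow> complex \<Rightarrow> nat \<Rightarrow> nat \<Rightarrow> complex"
  where "balanced_term t y b d d' n j =
    P (y / b) j * P (y / d) j * P (y / d') j / (P q j * P y j * P (y / t) j) *
    (b * d * d' / (t * y)) ^ j * (P (b * d * d' / (t * y)) (n - j) / P q (n - j))"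

definition balanced_sum :: "complex \<Rightarrow> complex \<Rightarrow> complex \<Rightarrow> complex \<Rightarrow> complex \<Rightarrow> nat \<Rightarrow> complex"
  where "balanced_sum t y b d d' n = (\<Sum>j\<le>n. balanced_term t y b d d' n j)"

text \<open>
The contiguous relation holds for the one-dimensional sum only after summation: the \<open>j\<close>-th terms of its
three sums combine to \<open>d - b\<close> times a difference of consecutive values of \<open>telescoper\<close>. The next two
lemmas are the underlying rational identities, with \<open>p = q\<close>, \<open>u = q\<^sup>j\<close> and \<open>z = q\<^sup>r\<^sup>+\<^sup>1\<close> for the term of
index \<open>j + 1\<close> out of \<open>n = j + r + 2\<close>. The first one is the case \<open>z = 1\<close> of the second, divided by \<open>1 - C\<close>;
it is stated separately because \<open>C = 1\<close> is possible.
\<close>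

lemma telescoping_identity_last:
  fixes b d t y u p :: complex
  assumes "b \<noteq> 0" "d \<noteq> 0" "t \<noteq> 0" "p \<noteq> 0"
  shows "d * (1 - b) * (1 - b / t) * (1 - y / b / p) * (1 - y / d * u) * (p * u)
      - b * (1 - d) * (1 - d / t) * (1 - y / b * u) * (1 - y / d / p) * (p * u)
      - (d - b) * (1 - b * d * (p * u) / t) * ((1 - y / b * u) * (1 - y / d * u))
    = - (d - b) * ((1 - p * u) * (1 - y * u) * (1 - y / t * u))"
  using assms by (simp add: field_simps) 

lemma telescoping_identity:
  fixes b d d' t y u p z C :: complex
  assumes "b \<noteq> 0" "d \<noteq> 0" "d' \<noteq> 0" "t \<noteq> 0" "p \<noteq> 0" "y \<noteq> 0"
  defines "C \<equiv> b * d * d' / (t * y)"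
  shows "d * (1 - b) * (1 - b / t) * (1 - y / b / p) * (1 - y / d * u) * (p * u) * (1 - C * z)
      - b * (1 - d) * (1 - d / t) * (1 - y / b * u) * (1 - y / d / p) * (p * u) * (1 - C * z)
      - (d - b) * (1 - b * d * (p * u * z) / t) * (1 - y / b * u) * (1 - y / d * u) * (1 - C)
    = (d - b) * ((1 - y / b * u) * (1 - y / d * u) * (1 - y / d' * (p * u)) * C * (1 - z)
        - (1 - p * u) * (1 - y * u) * (1 - y / t * u) * (1 - C * z))"
proof -
  define X where "X = d * (1 - b) * (1 - b / t) * (1 - y / b / p) * (1 - y / d * u) * (p * u)
      - b * (1 - d) * (1 - d / t) * (1 - y / b * u) * (1 - y / d / p) * (p * u)"
  define A where "A = (1 - y / b * u) * (1 - y / d * u)"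
  define B where "B = (1 - p * u) * (1 - y * u) * (1 - y / t * u)"
  have X: "X = (d - b) * (1 - b * d * (p * u) / t) * A - (d - b) * B"
  proof -
    have "X - (d - b) * (1 - b * d * (p * u) / t) * A = - (d - b) * B"
      unfolding X_def A_def B_def by (rule telescoping_identity_last) (use assms in auto)
    then show ?thesis by algebra
  qed
  have C: "y / d' * C = b * d / t"
    using assms by (simp add: C_def)
  have e: "b * d * v / t = b * d / t * v" for v by simp
  have "X * (1 - C * z) - (d - b) * (1 - b * d * (p * u * z) / t) * A * (1 - C)
     = (d - b) * (A * (C - b * d / t * (p * u)) * (1 - z) - B * (1 - C * z))"
    unfolding X e by (simp add: algebra_simps del: times_divide_eq_left times_divide_eq_right)
  also have "C - b * d / t * (p * u) = (1 - y / d' * (p * u)) * C"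
    unfolding C[symmetric] by (simp add: algebra_simps)
  finally have "X * (1 - C * z) - (d - b) * (1 - b * d * (p * u * z) / t) * A * (1 - C)
     = (d - b) * (A * ((1 - y / d' * (p * u)) * C) * (1 - z) - B * (1 - C * z))" .
  then show ?thesis
    unfolding X_def A_def B_def left_diff_distrib[of _ _ "1 - C * z"]
    by (simp only: mult.assoc)
qed

text \<open>
The antidifference found by \<open>q\<close>-Gosper summation. Its index is shifted so that the sum of the terms
up to \<open>j < n\<close> is \<open>d - b\<close> times the value at \<open>j\<close>.
\<close>

definition telescoper :: "complex \<Rightarrow> complex \<Rightarrow> complex \<Rightarrow> complex \<Rightarrow> complex \<Rightarrow> nat \<Rightarrow> nat \<Rightarrow> complex"
  where "telescoper t y b d d' n j =
    P (y / b) j * P (y / d) j * P (y / d') (Suc j) / (P q j * P y j * P (y / t) j) *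
    (b * d * d' / (t * y)) ^ Suc j * (P (b * d * d' / (t * y) * q) (n - Suc j) / P q (n - Suc j))"

definition contiguous_defect :: "complex \<Rightarrow> complex \<Rightarrow> complex \<Rightarrow> complex \<Rightarrow> complex \<Rightarrow> nat \<Rightarrow> nat \<Rightarrow> complex"
  where "contiguous_defect t y b d d' n j = d * (1 - b) * (1 - b / t) * balanced_term t y (b * q) d d' n j
     - b * (1 - d) * (1 - d / t) * balanced_term t y b (d * q) d' n j
     - (d - b) * (1 - b * d * q ^ n / t) * balanced_term t y b d d' n j"

lemma qpoch_div_q: "P (a / q) (Suc k) = (1 - a / q) * P a k"
  using q_nonzero qpoch_Suc_shift[of "a / q" q k] by simp

lemma contiguous_defect_0:
  assumes "b \<noteq> 0" "d \<noteq> 0" "d' \<noteq> 0" "t \<noteq> 0" "y \<noteq> 0"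
  shows "contiguous_defect t y b d d' (Suc n) 0 = (d - b) * telescoper t y b d d' (Suc n) 0"
proof -
  define C where "C = b * d * d' / (t * y)"
  have C: "(1 - y / d') * C = C - b * d / t"
    using assms by (simp add: C_def field_simps)
  have C': "b * q * d * d' / (t * y) = C * q" "b * (d * q) * d' / (t * y) = C * q"
    by (simp_all add: C_def)
  have r: "balanced_term t y (b * q) d d' (Suc n) 0 = (1 - C * q ^ Suc n) * (P (C * q) n / P q (Suc n))"
    "balanced_term t y b (d * q) d' (Suc n) 0 = (1 - C * q ^ Suc n) * (P (C * q) n / P q (Suc n))"
    "balanced_term t y b d d' (Suc n) 0 = (1 - C) * (P (C * q) n / P q (Suc n))"
    unfolding balanced_term_def C' C_def[symmetric] diff_zero qpoch_Suc_shift[of C] qpoch_Suc[of "C * q"]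
    by (simp_all add: ac_simps)
  have "contiguous_defect t y b d d' (Suc n) 0 = (d * (1 - b) * (1 - b / t) * (1 - C * q ^ Suc n)
     - b * (1 - d) * (1 - d / t) * (1 - C * q ^ Suc n)
     - (d - b) * (1 - b * d * q ^ Suc n / t) * (1 - C)) * (P (C * q) n / P q (Suc n))"
    unfolding contiguous_defect_def r left_diff_distrib[of _ _ "P (C * q) n / P q (Suc n)"] by (simp only: mult.assoc left_diff_distrib[of _ _ "P (C * q) n / P q (Suc n)"])
  also have "d * (1 - b) * (1 - b / t) * (1 - C * q ^ Suc n)
     - b * (1 - d) * (1 - d / t) * (1 - C * q ^ Suc n)
     - (d - b) * (1 - b * d * q ^ Suc n / t) * (1 - C)
    = (d - b) * (C - b * d / t) * (1 - q ^ Suc n)"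
    using assms(4) by (simp add: field_simps)
  also have "(d - b) * (C - b * d / t) * (1 - q ^ Suc n) * (P (C * q) n / P q (Suc n))
    = (d - b) * (C - b * d / t) * (P (C * q) n / P q n)"
    using one_minus_power_nonzero[of n] P_q_nonzero by (simp add: qpoch_Suc)
  also have "\<dots> = (d - b) * telescoper t y b d d' (Suc n) 0"
    unfolding telescoper_def C_def[symmetric] C[symmetric] by (simp add: qpoch_Suc)
  finally show ?thesis .
qed

lemma contiguous_defect_last:
  assumes "b \<noteq> 0" "d \<noteq> 0" "t \<noteq> 0"
    and "P y (Suc n) \<noteq> 0" "P (y / t) (Suc n) \<noteq> 0"
  shows "contiguous_defect t y b d d' (Suc n) (Suc n) = - (d - b) * telescoper t y b d d' (Suc n) n"
proof -
  define C where "C = b * d * d' / (t * y)"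
  have C': "b * q * d * d' / (t * y) = C * q" "b * (d * q) * d' / (t * y) = C * q"
    by (simp_all add: C_def)
  define Z where "Z = P (y / b) n * P (y / d) n * P (y / d') (Suc n) /
      (P q (Suc n) * P y (Suc n) * P (y / t) (Suc n)) * C ^ Suc n"
  have b: "y / (b * q) = y / b / q" and d: "y / (d * q) = y / d / q" by simp_all
  have r: "balanced_term t y (b * q) d d' (Suc n) (Suc n) = (1 - y / b / q) * (1 - y / d * q ^ n) * (q * q ^ n) * Z"
    "balanced_term t y b (d * q) d' (Suc n) (Suc n) = (1 - y / b * q ^ n) * (1 - y / d / q) * (q * q ^ n) * Z"
    "balanced_term t y b d d' (Suc n) (Suc n) = (1 - y / b * q ^ n) * (1 - y / d * q ^ n) * Z"
    unfolding balanced_term_def C' C_def[symmetric] b d qpoch_div_q power_mult_distrib Z_def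
      qpoch_Suc[of "y / b"] qpoch_Suc[of "y / d"] power_Suc[of q]
    by (simp_all add: ac_simps)
  have "contiguous_defect t y b d d' (Suc n) (Suc n) = 
     (d * (1 - b) * (1 - b / t) * (1 - y / b / q) * (1 - y / d * q ^ n) * (q * q ^ n)
      - b * (1 - d) * (1 - d / t) * (1 - y / b * q ^ n) * (1 - y / d / q) * (q * q ^ n)
      - (d - b) * (1 - b * d * (q * q ^ n) / t) * ((1 - y / b * q ^ n) * (1 - y / d * q ^ n))) * Z"
    unfolding contiguous_defect_def r left_diff_distrib[of _ _ Z] by (simp only: mult.assoc power_Suc[of q])
  also have "\<dots> = - (d - b) * ((1 - q * q ^ n) * (1 - y * q ^ n) * (1 - y / t * q ^ n)) * Z"
    by (subst telescoping_identity_last) (use assms q_nonzero in auto)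
  also have "\<dots> = - (d - b) * telescoper t y b d d' (Suc n) n"
  proof -
    define D where "D = (1 - q * q ^ n) * (1 - y * q ^ n) * (1 - y / t * q ^ n)"
    have "D \<noteq> 0"
      using one_minus_power_nonzero[of n] qpoch_nonzero_factor[OF assms(4), of n] qpoch_nonzero_factor[OF assms(5), of n]
      by (simp add: D_def)
    moreover have "Z = telescoper t y b d d' (Suc n) n / D"
      unfolding Z_def telescoper_def C_def[symmetric] D_def
      by (simp add: qpoch_Suc[of q] qpoch_Suc[of y] qpoch_Suc[of "y / t"] ac_simps)
    ultimately show ?thesis unfolding D_def[symmetric] by simp
  qed
  finally show ?thesis .
qed

lemma contiguous_defect_step:
  assumes "b \<noteq> 0" "d \<noteq> 0" "d' \<noteq> 0" "t \<noteq> 0" "y \<noteq> 0"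
    and "P y (Suc j) \<noteq> 0" "P (y / t) (Suc j) \<noteq> 0" and n: "n = Suc j + Suc r"
  shows "contiguous_defect t y b d d' n (Suc j) = (d - b) * (telescoper t y b d d' n (Suc j) - telescoper t y b d d' n j)"
proof -
  define C where "C = b * d * d' / (t * y)"
  have C': "b * q * d * d' / (t * y) = C * q" "b * (d * q) * d' / (t * y) = C * q"
    by (simp_all add: C_def)
  define Z where "Z = P (y / b) j * P (y / d) j * P (y / d') (Suc j) /
      (P q (Suc j) * P y (Suc j) * P (y / t) (Suc j)) * C ^ Suc j * (P (C * q) r / P q (Suc r))"
  have b: "y / (b * q) = y / b / q" and d: "y / (d * q) = y / d / q" by simp_all
  have qn: "q ^ n = q * q ^ j * q ^ Suc r" by (simp add: n power_add)
  have nj: "n - Suc j = Suc r" "n - Suc (Suc j) = r" by (simp_all add: n)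
  have regroup: "(d - b) * (a * w - x * k) * Z = (d - b) * (a * (w * Z) - k * (x * Z))" for a w x k
    by (simp add: algebra_simps)
  have r: "balanced_term t y (b * q) d d' n (Suc j) = (1 - y / b / q) * (1 - y / d * q ^ j) * (q * q ^ j) * (1 - C * q ^ Suc r) * Z"
    "balanced_term t y b (d * q) d' n (Suc j) = (1 - y / b * q ^ j) * (1 - y / d / q) * (q * q ^ j) * (1 - C * q ^ Suc r) * Z"
    "balanced_term t y b d d' n (Suc j) = (1 - y / b * q ^ j) * (1 - y / d * q ^ j) * (1 - C) * Z"
    unfolding balanced_term_def C' C_def[symmetric] b d qpoch_div_q power_mult_distrib Z_def nj
      qpoch_Suc[of "y / b"] qpoch_Suc[of "y / d"] qpoch_Suc[of "C * q"] qpoch_Suc_shift[of C] power_Suc[of q]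
    by (simp_all add: ac_simps)
  have "contiguous_defect t y b d d' n (Suc j) = 
     (d * (1 - b) * (1 - b / t) * (1 - y / b / q) * (1 - y / d * q ^ j) * (q * q ^ j) * (1 - C * q ^ Suc r)
      - b * (1 - d) * (1 - d / t) * (1 - y / b * q ^ j) * (1 - y / d / q) * (q * q ^ j) * (1 - C * q ^ Suc r)
      - (d - b) * (1 - b * d * (q * q ^ j * q ^ Suc r) / t) * (1 - y / b * q ^ j) * (1 - y / d * q ^ j) * (1 - C)) * Z"
    unfolding contiguous_defect_def r qn left_diff_distrib[of _ _ Z] by (simp only: mult.assoc)
  also have "\<dots> = (d - b) * ((1 - y / b * q ^ j) * (1 - y / d * q ^ j) * (1 - y / d' * (q * q ^ j)) * C * (1 - q ^ Suc r)
        - (1 - q * q ^ j) * (1 - y * q ^ j) * (1 - y / t * q ^ j) * (1 - C * q ^ Suc r)) * Z"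
    unfolding C_def by (subst telescoping_identity) (use assms q_nonzero in auto)
  also have "\<dots> = (d - b) * ((1 - y / b * q ^ j) * (1 - y / d * q ^ j) * (1 - y / d' * (q * q ^ j)) * C * ((1 - q ^ Suc r) * Z)
        - (1 - C * q ^ Suc r) * ((1 - q * q ^ j) * (1 - y * q ^ j) * (1 - y / t * q ^ j) * Z))"
    by (rule regroup)
  also have "(1 - q * q ^ j) * (1 - y * q ^ j) * (1 - y / t * q ^ j) * Z = 
      P (y / b) j * P (y / d) j * P (y / d') (Suc j) /
      (P q j * P y j * P (y / t) j) * C ^ Suc j * (P (C * q) r / P q (Suc r))"
    using one_minus_power_nonzero[of j] qpoch_nonzero_factor[OF assms(6), of j] qpoch_nonzero_factor[OF assms(7), of j] assms(4)
    unfolding Z_def qpoch_Suc[of q q j] qpoch_Suc[of y] qpoch_Suc[of "y / t"]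
    by (simp add: ac_simps)
  also have "(1 - C * q ^ Suc r) * \<dots> = telescoper t y b d d' n j"
    unfolding telescoper_def C_def[symmetric] nj qpoch_Suc[of "C * q"] by (simp add: ac_simps)
  also have "(1 - q ^ Suc r) * Z = P (y / b) j * P (y / d) j * P (y / d') (Suc j) /
      (P q (Suc j) * P y (Suc j) * P (y / t) (Suc j)) * C ^ Suc j * (P (C * q) r / P q r)"
    using one_minus_power_nonzero[of r] unfolding Z_def qpoch_Suc[of q q r] by (simp add: ac_simps)
  also have "(1 - y / b * q ^ j) * (1 - y / d * q ^ j) * (1 - y / d' * (q * q ^ j)) * C * \<dots> = telescoper t y b d d' n (Suc j)"
    unfolding telescoper_def C_def[symmetric] nj qpoch_Suc[of "y / b"] qpoch_Suc[of "y / d"]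
      qpoch_Suc[of "y / d'" q "Suc j"] by (simp add: ac_simps)
  finally show ?thesis .
qed

lemma balanced_sum_contiguous:
  assumes "b \<noteq> 0" "d \<noteq> 0" "d' \<noteq> 0" "t \<noteq> 0" "y \<noteq> 0"
    and y: "P y n \<noteq> 0" "P (y / t) n \<noteq> 0"
  shows "d * (1 - b) * (1 - b / t) * balanced_sum t y (b * q) d d' n - b * (1 - d) * (1 - d / t) * balanced_sum t y b (d * q) d' n
     = (d - b) * (1 - b * d * q ^ n / t) * balanced_sum t y b d d' n"
proof -
  have "(\<Sum>j\<le>n. contiguous_defect t y b d d' n j) = 0"
  proof (cases n)
    case 0
    then show ?thesis using assms(4) by (simp add: contiguous_defect_def balanced_term_def field_simps)
  next
    case (Suc m)
    have partial: "(\<Sum>j\<le>i. contiguous_defect t y b d d' n j) = (d - b) * telescoper t y b d d' n i" if "i \<le> m" for i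
      using that
    proof (induction i)
      case 0
      then show ?case using contiguous_defect_0[OF assms(1-5), of m] Suc by simp
    next
      case (Suc i)
      from Suc.prems have "n = Suc i + Suc (m - Suc i)" using \<open>n = Suc m\<close> by simp
      from contiguous_defect_step[OF assms(1-5) _ _ this]
      have T: "contiguous_defect t y b d d' n (Suc i) = (d - b) * (telescoper t y b d d' n (Suc i) - telescoper t y b d d' n i)"
        using qpoch_nonzero_le[OF y(1), of "Suc i"] qpoch_nonzero_le[OF y(2), of "Suc i"] \<open>n = Suc m\<close> Suc.prems by simp
      have IH: "(\<Sum>j\<le>i. contiguous_defect t y b d d' n j) = (d - b) * telescoper t y b d d' n i"
        using Suc by simp
      show ?case unfolding sum.atMost_Suc IH T by (simp only: right_diff_distrib) simp
    qed
    have last: "contiguous_defect t y b d d' n n = - (d - b) * telescoper t y b d d' n m"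
      using contiguous_defect_last[OF assms(1,2,4), of y m d'] y Suc by simp
    have "(\<Sum>j\<le>n. contiguous_defect t y b d d' n j) = (d - b) * telescoper t y b d d' n m + contiguous_defect t y b d d' n n"
      using partial[of m] by (simp add: Suc)
    then show ?thesis unfolding last by (simp flip: distrib_right)
  qed
  moreover have "(\<Sum>j\<le>n. contiguous_defect t y b d d' n j) =
      d * (1 - b) * (1 - b / t) * balanced_sum t y (b * q) d d' n - b * (1 - d) * (1 - d / t) * balanced_sum t y b (d * q) d' n
     - (d - b) * (1 - b * d * q ^ n / t) * balanced_sum t y b d d' n"
    unfolding contiguous_defect_def balanced_sum_def sum_distrib_left sum_subtractf ..
  ultimately show ?thesis by simp
qed

section \<open>The two-point transformation\<close>

text \<open>
At \<open>b = y\<close> a numerator parameter cancels the denominator parameter, and the two-point sum becomes summable.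
\<close>

lemma two_point_sum_initial:
  assumes "weight_regular t n" "P y n \<noteq> 0" "P (y / t) n \<noteq> 0"
  shows "two_point_sum t y y d d' n = P (d * d' / t) n / P q n"
proof -
  have "qpoch2 t y k (n - k) \<noteq> 0" if "k \<le> n" for k
    using that qpoch_nonzero_le[OF assms(2), of k] qpoch_nonzero_le[OF assms(3), of "n - k"]
    by (simp add: qpoch2_def)
  then show ?thesis
    unfolding two_point_sum_def two_point_Vandermonde[OF assms(1), symmetric] by (intro sum.cong) simp_all
qed

lemma balanced_sum_initial:
  assumes "y \<noteq> 0"
  shows "balanced_sum t y y d d' n = P (d * d' / t) n / P q n"
proof -
  have "balanced_term t y y d d' n j = 0" if "j \<noteq> 0" for j
  proof -
    have "P 1 j = 0" using that by (cases j) (simp_all add: qpoch_Suc_shift)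
    then show ?thesis using assms by (simp add: balanced_term_def)
  qed
  then have "balanced_sum t y y d d' n = (\<Sum>j\<in>{0}. balanced_term t y y d d' n j)"
    unfolding balanced_sum_def by (intro sum.mono_neutral_right) auto
  then show ?thesis using assms by (simp add: balanced_term_def)
qed

text \<open>
The contiguous relation expresses the value at \<open>b q\<close> through values at \<open>b\<close>, one of them with \<open>d q\<close> in place
of \<open>d\<close>; hence the induction on \<open>M\<close> is over all \<open>d\<close>. For \<open>M < n\<close> the coefficient \<open>(1 - b) (1 - b/t)\<close> at \<open>b = y q\<^sup>M\<close>
is a factor of \<open>(y)\<^sub>n (y/t)\<^sub>n\<close>, so that it does not vanish.
\<close>

lemma two_point_transformation_special:
  assumes "weight_regular t n" "y \<noteq> 0" "P y n \<noteq> 0" "P (y / t) n \<noteq> 0" "d' \<noteq> 0"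
  shows "d \<noteq> 0 \<Longrightarrow> M \<le> n \<Longrightarrow> two_point_sum t y (y * q ^ M) d d' n = balanced_sum t y (y * q ^ M) d d' n"
proof (induction M arbitrary: d)
  case 0
  then show ?case using two_point_sum_initial[OF assms(1,3,4)] balanced_sum_initial[OF assms(2)] by simp
next
  case (Suc M)
  define b where "b = y * q ^ M"
  have t: "t \<noteq> 0" using assms(1) by (simp add: weight_regular_def)
  have b: "b \<noteq> 0" "1 - b \<noteq> 0" "1 - b / t \<noteq> 0"
    using assms(2) q_nonzero Suc.prems qpoch_nonzero_factor[OF assms(3), of M]
      qpoch_nonzero_factor[OF assms(4), of M] by (auto simp: b_def)
  have IH: "two_point_sum t y b d d' n = balanced_sum t y b d d' n" "two_point_sum t y b (d * q) d' n = balanced_sum t y b (d * q) d' n"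
    using Suc.IH[of d] Suc.IH[of "d * q"] Suc.prems q_nonzero by (auto simp: b_def)
  have "d * (1 - b) * (1 - b / t) * two_point_sum t y (b * q) d d' n = d * (1 - b) * (1 - b / t) * balanced_sum t y (b * q) d d' n"
  proof -
    have eq: "A = B" if "A - D = E" "B - D = E" for A B D E :: complex
      using that by (metis diff_add_cancel)
    show ?thesis
      by (rule eq[OF two_point_sum_contiguous[OF t, of d b y d' n, unfolded IH]
            balanced_sum_contiguous[OF b(1) Suc.prems(1) assms(5) t assms(2-4)]])
  qed
  then have "two_point_sum t y (b * q) d d' n = balanced_sum t y (b * q) d d' n"
    using b Suc.prems t by simp
  then show ?case by (simp add: b_def ac_simps)
qed

definition lin_poly :: "complex \<Rightarrow> nat \<Rightarrow> complex poly"
  where "lin_poly a k = (\<Prod>i<k. [:1, - (a * q ^ i):])"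

definition monic_poly :: "complex \<Rightarrow> nat \<Rightarrow> complex poly"
  where "monic_poly a k = (\<Prod>i<k. [:- (a * q ^ i), 1:])"

lemma poly_lin_poly: "poly (lin_poly a k) x = P (a * x) k"
  by (simp add: lin_poly_def qpoch_def poly_prod ac_simps)

lemma poly_monic_poly: "x \<noteq> 0 \<Longrightarrow> poly (monic_poly a k) x = x ^ k * P (a / x) k"
  by (induction k) (simp_all add: monic_poly_def qpoch_Suc field_simps)

lemma degree_lin_poly: "degree (lin_poly a k) \<le> k"
  unfolding lin_poly_def by (rule order.trans[OF degree_prod_sum_le]) (auto intro: order.trans[OF sum_bounded_above[where K = 1]])

lemma degree_monic_poly: "degree (monic_poly a k) \<le> k"
  unfolding monic_poly_def by (rule order.trans[OF degree_prod_sum_le]) (auto intro: order.trans[OF sum_bounded_above[where K = 1]])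

lemma inj_power_q: "inj (\<lambda>i. q ^ i)"
proof (rule linorder_injI)
  fix i j :: nat assume "i < j"
  then have "q ^ j = q ^ i * q ^ (j - i)" by (simp flip: power_add)
  then show "q ^ i \<noteq> q ^ j" using q_power_neq_1[of "j - i"] \<open>i < j\<close> q_nonzero by simp
qed

text \<open>
The powers of \<open>C = b d d' / (t y)\<close> clear the denominators of \<open>(y/b)\<^sub>j\<close>, so both sides are polynomials in \<open>b\<close> of
degree at most \<open>n\<close>, and they agree at the \<open>n + 1\<close> points \<open>y q\<^sup>M\<close> with \<open>M \<le> n\<close>.
\<close>

lemma two_point_transformation:
  assumes "weight_regular t n" "y \<noteq> 0" "P y n \<noteq> 0" "P (y / t) n \<noteq> 0" "b \<noteq> 0" "d \<noteq> 0" "d' \<noteq> 0"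
  shows "two_point_sum t y b d d' n = balanced_sum t y b d d' n"
proof -
  define g where "g = d * d' / (t * y)"
  \<comment> \<open>The two sides as polynomials in \<open>b\<close>; \<open>g\<close> is \<open>C / b\<close>.\<close>
  define pS where "pS = (\<Sum>k\<le>n. smult (weight t k (n - k) * (qpoch2 t d k (n - k) * qpoch2 t d' k (n - k) / qpoch2 t y k (n - k)))
      (lin_poly 1 k * lin_poly (1 / t) (n - k)))"
  define pR where "pR = (\<Sum>j\<le>n. smult (P (y / d) j * P (y / d') j / (P q j * P y j * P (y / t) j) * g ^ j / P q (n - j))
      (monic_poly y j * lin_poly g (n - j)))"
  have two_point_sum: "two_point_sum t y x d d' n = poly pS x" for x
    by (simp add: two_point_sum_def pS_def poly_sum poly_lin_poly qpoch2_def ac_simps)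
  have balanced_sum: "balanced_sum t y x d d' n = poly pR x" if "x \<noteq> 0" for x
  proof -
    have "x * d * d' / (t * y) = g * x" by (simp add: g_def)
    then show ?thesis
      unfolding balanced_sum_def pR_def poly_sum balanced_term_def using that
      by (intro sum.cong refl) (simp add: poly_lin_poly poly_monic_poly power_mult_distrib)
  qed
  let ?A = "(\<lambda>M. y * q ^ M) ` {..n}"
  have "inj_on (\<lambda>M. y * q ^ M) {..n}"
    using inj_power_q assms(2) by (auto simp: inj_on_def)
  then have card: "card ?A = Suc n" by (simp add: card_image)
  have "degree (lin_poly 1 k * lin_poly (1 / t) (n - k)) \<le> n" if "k \<le> n" for k
    using degree_mult_le[of "lin_poly 1 k" "lin_poly (1 / t) (n - k)"]
      degree_lin_poly[of 1 k] degree_lin_poly[of "1 / t" "n - k"] that by linarith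
  then have dS: "degree pS \<le> n"
    unfolding pS_def by (intro degree_sum_le) (auto intro: order.trans[OF degree_smult_le])
  have "degree (monic_poly y j * lin_poly g (n - j)) \<le> n" if "j \<le> n" for j
    using degree_mult_le[of "monic_poly y j" "lin_poly g (n - j)"]
      degree_monic_poly[of y j] degree_lin_poly[of g "n - j"] that by linarith
  then have dR: "degree pR \<le> n"
    unfolding pR_def by (intro degree_sum_le) (auto intro: order.trans[OF degree_smult_le])
  have "pS = pR"
  proof (rule poly_eqI_degree[of ?A])
    fix x assume "x \<in> ?A"
    then obtain M where M: "M \<le> n" "x = y * q ^ M" by auto
    then show "poly pS x = poly pR x"
      using two_point_transformation_special[OF assms(1-4,7,6) M(1)] two_point_sum[of x] balanced_sum[of x] assms(2) q_nonzero by simp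
  qed (use card dS dR in auto)
  then show ?thesis using two_point_sum[of b] balanced_sum[OF assms(5)] by simp
qed

lemma tendsto_qpoch: "(f \<longlongrightarrow> a) F \<Longrightarrow> ((\<lambda>x. P (f x) k) \<longlongrightarrow> P a k) F"
  unfolding qpoch_def by (intro tendsto_intros)

lemma eventually_qpoch_nonzero: "eventually (\<lambda>c. P c k \<noteq> 0) (at a)"
proof -
  have "eventually (\<lambda>c. c \<noteq> 1 / q ^ i) (at a)" for i
    by (rule eventually_neq_at_within)
  then have "eventually (\<lambda>c. \<forall>i\<in>{..<k}. c \<noteq> 1 / q ^ i) (at a)"
    by (intro eventually_ball_finite) auto
  then show ?thesis
    by eventually_elim (use q_nonzero in \<open>auto simp: qpoch_def field_simps\<close>)
qed

text \<open>
The transformation multiplied by \<open>(c)\<^sub>N\<close>, where \<open>y = c t\<close>. In this form it makes sense for \<open>(c)\<^sub>N = 0\<close>, and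
it holds there by continuity in \<open>c\<close>. That case is required: for the second very well-poised series,
\<open>c = q\<^sup>1\<^sup>-\<^sup>N / \<phi>\<close>, and \<open>\<phi>\<close> may be one of \<open>1, q\<^sup>-\<^sup>1, \<dots>, q\<^sup>1\<^sup>-\<^sup>N\<close>.
\<close>

lemma two_point_transformation_regularized:
  assumes "weight_regular t n" "P (c * t) n \<noteq> 0" "c \<noteq> 0" "b \<noteq> 0" "d \<noteq> 0" "d' \<noteq> 0" and n: "n \<le> N"
  shows "(\<Sum>k\<le>n. weight t k (n - k) * (qpoch2 t b k (n - k) * qpoch2 t d k (n - k) * qpoch2 t d' k (n - k))
            * P (c * q ^ (n - k)) (N - (n - k)) / P (c * t) k)
       = (\<Sum>j\<le>n. P (c * t / b) j * P (c * t / d) j * P (c * t / d') j / (P q j * P (c * t) j)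
            * P (c * q ^ j) (N - j) * (b * d * d' / (t * (c * t))) ^ j
            * (P (b * d * d' / (t * (c * t))) (n - j) / P q (n - j)))"
    (is "?f c = ?g c")
proof -
  have t: "t \<noteq> 0" using assms(1) by (simp add: weight_regular_def)
  have generic: "?f c = ?g c" if "P c N \<noteq> 0" "c \<noteq> 0" "P (c * t) n \<noteq> 0" for c
  proof -
    have Pc: "P (c * q ^ j) (N - j) = P c N / P c j" if "j \<le> n" for j
      using qpoch_split[of j N c q] qpoch_nonzero_le[OF \<open>P c N \<noteq> 0\<close>, of j] that n by simp
    have "?f c = P c N * two_point_sum t (c * t) b d d' n"
      unfolding two_point_sum_def sum_distrib_left
    proof (intro sum.cong refl, goal_cases)
      case (1 k)
      then show ?case using t Pc[of "n - k"] by (simp add: qpoch2_def[of t "c * t"] ac_simps)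
    qed
    also have "two_point_sum t (c * t) b d d' n = balanced_sum t (c * t) b d d' n"
      by (rule two_point_transformation) (use assms t that n qpoch_nonzero_le[of c q N n] in auto)
    also have "P c N * \<dots> = ?g c"
      unfolding balanced_sum_def balanced_term_def sum_distrib_left
      by (intro sum.cong refl) (use t in \<open>simp add: Pc\<close>)
    finally show ?thesis .
  qed
  have f: "(?f \<longlongrightarrow> ?f c) (at c)"
    by (intro tendsto_intros tendsto_qpoch) (use qpoch_nonzero_le[OF assms(2)] in auto)
  have g: "(?g \<longlongrightarrow> ?g c) (at c)"
    by (intro tendsto_intros tendsto_qpoch) (use qpoch_nonzero_le[OF assms(2)] P_q_nonzero assms t in auto)
  have "((\<lambda>c. P (c * t) n) \<longlongrightarrow> P (c * t) n) (at c)"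
    by (intro tendsto_intros tendsto_qpoch)
  then have "eventually (\<lambda>c. P (c * t) n \<noteq> 0) (at c)"
    by (rule tendsto_imp_eventually_ne) (rule assms)
  then have "eventually (\<lambda>c. ?f c = ?g c) (at c)"
    using eventually_qpoch_nonzero[of N c] eventually_neq_at_within[of 0 c UNIV]
    by eventually_elim (rule generic)
  then have "(?g \<longlongrightarrow> ?f c) (at c)"
    using f by (rule Lim_transform_eventually[rotated])
  then show ?thesis using g by (rule tendsto_unique[rotated]) simp
qed

section \<open>From the very well-poised series to two-point sums\<close>

text \<open>
For given \<open>n\<close> and \<open>k\<close>, every reversal produces the same power of \<open>q\<close>, whatever the parameter. It cancels
from a quotient in which numerator and denominator contain equally many reversed products, so its
exponent can remain implicit.
\<close>

definition reversal_factor :: "nat \<Rightarrow> nat \<Rightarrow> complex"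
  where "reversal_factor n k = (\<Prod>i<k. q ^ Suc i / q ^ n)"

lemma reversal_factor_nonzero: "reversal_factor n k \<noteq> 0"
  using q_nonzero by (simp add: reversal_factor_def)

lemma qpoch_reverse:
  assumes "x \<noteq> 0"
  shows "k \<le> n \<Longrightarrow> P (q / (q ^ n * x)) k = (- 1 / x) ^ k * reversal_factor n k * P (x * q ^ (n - k)) k"
proof (induction k)
  case 0
  then show ?case by (simp add: reversal_factor_def)
next
  case (Suc k)
  have qn: "q ^ n = q ^ Suc k * q ^ (n - Suc k)"
    using Suc.prems by (simp del: power_Suc flip: power_add)
  have nk: "q ^ (n - k) = q * q ^ (n - Suc k)"
    using Suc.prems by (simp flip: power_Suc add: Suc_diff_Suc)
  have "1 - q / (q ^ n * x) * q ^ k = (- 1 / x) * (q ^ Suc k / q ^ n) * (1 - x * q ^ (n - Suc k))"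
    unfolding qn using assms q_nonzero by (simp add: field_simps)
  moreover have "P (x * q ^ (n - Suc k)) (Suc k) = (1 - x * q ^ (n - Suc k)) * P (x * q ^ (n - k)) k"
    unfolding qpoch_Suc_shift nk by (simp add: ac_simps)
  ultimately show ?case
    using Suc by (simp add: qpoch_Suc[of "q / (q ^ n * x)"] reversal_factor_def)
qed

text \<open>
Cancellation in a single term of the series, with each shifted factorial an atom: \<open>x\<^sub>i\<close> and \<open>y\<^sub>i\<close> are the powers
produced by the reversals, and suffixes \<open>l\<close> and \<open>k\<close> mark the two halves of a product of length \<open>n = k + l\<close>.
\<close>

lemma W_term_cancellation:
  fixes Bl :: complex
  assumes "th \<noteq> 0" "Bk \<noteq> 0" "Dk \<noteq> 0" "Dk' \<noteq> 0" "Qk \<noteq> 0" "Tk \<noteq> 0" "Ql \<noteq> 0" "Tl \<noteq> 0"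
    "y1 \<noteq> 0" "y2 \<noteq> 0" "y3 \<noteq> 0" "pq \<noteq> 0" "Y \<noteq> 0" "Z \<noteq> 0"
    and pow: "x1 * x2 * x3 * u = y1 * y2 * y3 * s"
    and g: "s * g / (h * f) = w"
  shows "(Bl * Bk) * (Dl * Dk) * (Dl' * Dk') / ((Ql * Qk) * (f * (Tl * Tk))) *
     (g * ((x1 * th * Tk) * (b * (d * (d' * ((x2 * th * Ek) * (x3 * th * Qk)))))) /
       (h * (pq * ((y1 * th * Bk) * ((y2 * th * Dk) * ((y3 * th * Dk') * (Y * Z)))))) * u)
   = w / ((pq * Tl) * (Z * Ql)) * ((b * Bl) * (d * Dl) * (d' * Dl')) * Ek / Y"
proof -
  have "(Bl * Bk) * (Dl * Dk) * (Dl' * Dk') / ((Ql * Qk) * (f * (Tl * Tk))) *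
     (g * ((x1 * th * Tk) * (b * (d * (d' * ((x2 * th * Ek) * (x3 * th * Qk)))))) /
       (h * (pq * ((y1 * th * Bk) * ((y2 * th * Dk) * ((y3 * th * Dk') * (Y * Z)))))) * u)
   = (x1 * x2 * x3 * u) / (y1 * y2 * y3) * (g / (h * f)) / ((pq * Tl) * (Z * Ql)) * ((b * Bl) * (d * Dl) * (d' * Dl')) * Ek / Y"
    using assms(1-14) by (simp add: field_simps)
  also have "(x1 * x2 * x3 * u) / (y1 * y2 * y3) * (g / (h * f)) = w"
    unfolding pow g[symmetric] using assms(9-11) by simp
  finally show ?thesis .
qed

lemma powi_minus: "q powi (- int n) = 1 / q ^ n"
  by (simp add: power_int_minus divide_inverse)

text \<open>
Reversing the products with argument proportional to \<open>q\<^sup>-\<^sup>n\<close> replaces \<open>(b/t)\<^sub>n / (t q\<^sup>1\<^sup>-\<^sup>n / b)\<^sub>k\<close> by a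
multiple of \<open>(b/t)\<^bsub>n-k\<^esub>\<close>, and likewise for \<open>d\<close>, \<open>d'\<close>. Three reversals in the numerator match three in the
denominator, and the argument of the series is exactly what absorbs the remaining powers. The
factor \<open>(c q\<^bsup>n-k\<^esup>)\<^sub>k\<close> is left undivided by \<open>(c)\<^sub>n\<close>, which may vanish.
\<close>

lemma W_conversion:
  fixes t b d d' e :: complex
  assumes nz: "t \<noteq> 0" "b \<noteq> 0" "d \<noteq> 0" "d' \<noteq> 0" "e \<noteq> 0"
    and t1: "P (1 / t) n \<noteq> 0"
    and den: "W_denom (t * q powi (- int n)) [b, d, d', e * q powi (- int n), q powi (- int n)] q n \<noteq> 0"
  defines "c \<equiv> q / e"
  shows "weight_regular t n" and "P (c * t) n \<noteq> 0"
    and "P (b / t) n * P (d / t) n * P (d' / t) n / (P q n * P (1 / t) n) *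
      basic_W (t * q powi (- int n)) [b, d, d', e * q powi (- int n), q powi (- int n)] q
        (t^2 * q^2 / (b * d * d' * e)) =
      (\<Sum>k\<le>n. weight t k (n - k) * (qpoch2 t b k (n - k) * qpoch2 t d k (n - k) * qpoch2 t d' k (n - k))
            * P (c * q ^ (n - k)) k / P (c * t) k)"
proof -
  define a where "a = t / q ^ n"
  have a: "a * q / x = q / (q ^ n * (x / t))" if "x \<noteq> 0" for x
    using that nz q_nonzero by (simp add: a_def field_simps)
  have ae: "a * q / (e / q ^ n) = c * t" and a1: "a * q / (1 / q ^ n) = q * t"
    using nz q_nonzero by (simp_all add: a_def c_def field_simps)
  have ta: "t * (1 / q ^ n) = a" "e * (1 / q ^ n) = e / q ^ n" by (simp_all add: a_def)
  have W_denom: "W_denom (t * q powi (- int n)) [b, d, d', e * q powi (- int n), q powi (- int n)] q k =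
    (1 - a) * (P q k * (P (q / (q ^ n * (b / t))) k * (P (q / (q ^ n * (d / t))) k * (P (q / (q ^ n * (d' / t))) k *
       (P (c * t) k * P (q * t) k)))))" for k
    by (simp only: W_denom_def powi_minus ta list.map a[OF nz(2)] a[OF nz(3)] a[OF nz(4)] ae a1
        qpochs_def prod_list.Cons prod_list.Nil mult_1_right)
  have den': "1 - a \<noteq> 0" "P (q / (q ^ n * (b / t))) n \<noteq> 0" "P (q / (q ^ n * (d / t))) n \<noteq> 0"
     "P (q / (q ^ n * (d' / t))) n \<noteq> 0" "P (c * t) n \<noteq> 0" "P (q * t) n \<noteq> 0"
    using den unfolding W_denom by auto
  have tqn: "t \<noteq> q ^ n" using den'(1) q_nonzero by (auto simp: a_def)
  have shift: "(1 - 1 / t) * P (q / t) n = (1 - q ^ n / t) * P (1 / t) n"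
    using qpoch_shift[of "1 / t" q n] nz by (simp add: field_simps)
  with t1 tqn nz have t2: "t \<noteq> 1" "P (q / t) n \<noteq> 0"
    by auto
  show reg: "weight_regular t n" using nz t2 den' by (simp add: weight_regular_def)
  show ct: "P (c * t) n \<noteq> 0" by fact
  define f where "f = (1 - 1 / t) / (1 - q ^ n / t)"
  have f: "P (1 / t) n = f * P (q / t) n"
  proof -
    have "1 - q ^ n / t \<noteq> 0" using tqn nz by simp
    then have "P (1 / t) n = (1 - 1 / t) * P (q / t) n / (1 - q ^ n / t)"
      by (rule eq_divide_imp) (simp only: shift mult.commute)
    then show ?thesis by (simp add: f_def)
  qed
  have rev_b: "P (q / (q ^ n * (x / t))) k = (- t / x) ^ k * reversal_factor n k * P (x / t * q ^ (n - k)) k"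
    if "x \<noteq> 0" "k \<le> n" for x k
    using qpoch_reverse[of "x / t" k n] that nz by simp
  show "P (b / t) n * P (d / t) n * P (d' / t) n / (P q n * P (1 / t) n) *
      basic_W (t * q powi (- int n)) [b, d, d', e * q powi (- int n), q powi (- int n)] q
        (t^2 * q^2 / (b * d * d' * e)) =
      (\<Sum>k\<le>n. weight t k (n - k) * (qpoch2 t b k (n - k) * qpoch2 t d k (n - k) * qpoch2 t d' k (n - k))
            * P (c * q ^ (n - k)) k / P (c * t) k)"
    (is "?pre * _ = _")
  proof -
    have mem: "q powi (- int n) \<in> set [b, d, d', e * q powi (- int n), q powi (- int n)]"
      by simp
    have "basic_W (t * q powi (- int n)) [b, d, d', e * q powi (- int n), q powi (- int n)] q
        (t^2 * q^2 / (b * d * d' * e)) =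
       (\<Sum>k\<le>n. (1 - a * q ^ (2 * k)) * (P a k * (P b k * (P d k * (P d' k * (P (e / q ^ n) k * P (1 / q ^ n) k))))) /
         ((1 - a) * (P q k * (P (q / (q ^ n * (b / t))) k * (P (q / (q ^ n * (d / t))) k * (P (q / (q ^ n * (d' / t))) k *
            (P (c * t) k * P (q * t) k)))))) *
          (t^2 * q^2 / (b * d * d' * e)) ^ k)"
      unfolding basic_W_terminating[OF q_nonzero mem] W_denom unfolding powi_minus ta
      by (simp only: qpochs_def list.map prod_list.Cons prod_list.Nil mult_1_right)
    moreover have "?pre * ((1 - a * q ^ (2 * k)) * (P a k * (P b k * (P d k * (P d' k * (P (e / q ^ n) k * P (1 / q ^ n) k))))) /
         ((1 - a) * (P q k * (P (q / (q ^ n * (b / t))) k * (P (q / (q ^ n * (d / t))) k * (P (q / (q ^ n * (d' / t))) k *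
            (P (c * t) k * P (q * t) k)))))) *
          (t^2 * q^2 / (b * d * d' * e)) ^ k) =
       weight t k (n - k) * (qpoch2 t b k (n - k) * qpoch2 t d k (n - k) * qpoch2 t d' k (n - k))
            * P (c * q ^ (n - k)) k / P (c * t) k" if k: "k \<le> n" for k
    proof -
      define l where "l = n - k"
      have l: "l \<le> n" "n - l = k" using k by (auto simp: l_def)
      have split: "P x n = P x l * P (x * q ^ l) k" for x
        using qpoch_split[of l n x q] l by simp
      have Pa: "P a k = (- t / q) ^ k * reversal_factor n k * P (q / t * q ^ l) k"
        using qpoch_reverse[of "q / t" k n] k nz q_nonzero by (simp add: l_def a_def)
      have Pe: "P (e / q ^ n) k = (- e / q) ^ k * reversal_factor n k * P (c * q ^ l) k"
        using qpoch_reverse[of "q / e" k n] k nz q_nonzero by (simp add: l_def c_def)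
      have P1: "P (1 / q ^ n) k = (- 1 / q) ^ k * reversal_factor n k * P (q * q ^ l) k"
        using qpoch_reverse[of q k n] k q_nonzero by (simp add: l_def)
      have qn: "q ^ n = q ^ k * q ^ l" using k by (simp add: l_def flip: power_add)
      have nonz: "P (x / t * q ^ l) k \<noteq> 0" if "x \<noteq> 0" "P (q / (q ^ n * (x / t))) n \<noteq> 0" for x
        using qpoch_nonzero_le[OF that(2) k] unfolding rev_b[OF that(1) k] by (simp add: l_def)
      have pow: "(- t / q) ^ k * (- e / q) ^ k * (- 1 / q) ^ k * (t^2 * q^2 / (b * d * d' * e)) ^ k
         = (- t / b) ^ k * (- t / d) ^ k * (- t / d') ^ k * (1 / q) ^ k"
        unfolding power_mult_distrib[symmetric]
        using nz q_nonzero by (simp add: field_simps power2_eq_square)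
      have w: "(1 / q) ^ k * (1 - a * q ^ (2 * k)) / ((1 - a) * f) = (t * q ^ k - q ^ l) / (t - 1)"
      proof -
        have "(1 - a) * f = (t - 1) * (- 1 / q ^ n)"
          using nz t2 tqn q_nonzero by (simp add: a_def f_def field_simps)
        moreover have "(1 / q) ^ k * (1 - a * q ^ (2 * k)) = (t * q ^ k - q ^ l) * (- 1 / q ^ n)"
          unfolding a_def qn using q_nonzero
          by (simp add: field_simps power_mult power2_eq_square mult_2 power_add)
        moreover have "(x * (- 1 / q ^ n)) / (y * (- 1 / q ^ n)) = x / y" for x y
          using q_nonzero by simp
        ultimately show ?thesis by (simp only:)
      qed
      have nzl: "P (q * t) k \<noteq> 0" "P (c * t) k \<noteq> 0" "P (q / t) l \<noteq> 0" "P (q / t * q ^ l) k \<noteq> 0"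
        "P (q * q ^ l) k \<noteq> 0"
        using qpoch_nonzero_le[OF den'(6) k] qpoch_nonzero_le[OF den'(5) k]
          t2(2)[unfolded split] P_q_nonzero[of n, unfolded split] by auto
      have weight: "weight t k l = (t * q ^ k - q ^ l) / (t - 1) / ((P q k * P (q / t) l) * (P (q * t) k * P q l))"
        using nz by (simp add: weight_def qpoch2_def)
      show ?thesis
        unfolding f unfolding rev_b[OF nz(2) k] rev_b[OF nz(3) k] rev_b[OF nz(4) k] Pa Pe P1 split l_def[symmetric] weight
          qpoch2_def
        by (rule W_term_cancellation[OF reversal_factor_nonzero nonz nonz nonz _ _ _ _ _ _ _ _ _ _ pow w])
           (use nz nzl P_q_nonzero den' in auto)
    qed
    ultimately show ?thesis
      by (simp only: sum_distrib_left) (intro sum.cong refl, simp)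
  qed
qed

section \<open>Convolution and reversal\<close>

text \<open>
As power series, the factors built from \<open>C\<close> and \<open>C'\<close> are inverse to each other, by \<open>q_Vandermonde\<close> with
\<open>C C' = 1\<close>.
\<close>

lemma convolution:
  fixes \<alpha> \<alpha>' :: "nat \<Rightarrow> complex"
  assumes CC: "C * C' = 1"
  shows "(\<Sum>K\<le>N. (\<Sum>j\<le>K. \<alpha> j * C ^ j * (P C (K - j) / P q (K - j))) *
      (C' ^ K * (\<Sum>i\<le>N - K. \<alpha>' i * C' ^ i * (P C' (N - K - i) / P q (N - K - i)))))
    = (\<Sum>j\<le>N. \<alpha> j * (\<alpha>' (N - j) * C' ^ (N - j)))"
proof -
  define A where "A = Abs_fps \<alpha>"
  define A' where "A' = Abs_fps (\<lambda>n. \<alpha>' n * C' ^ n)"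
  define V where "V = Abs_fps (\<lambda>n. C' ^ n * (P C n / P q n))"
  define V' where "V' = Abs_fps (\<lambda>n. P C' n / P q n)"
  have "V * V' = 1"
  proof (rule fps_ext)
    fix n
    have "fps_nth (V * V') n = (\<Sum>m\<le>n. C' ^ m * (P C m * P C' (n - m)) / (P q m * P q (n - m)))"
      by (simp add: fps_mult_nth V_def V'_def atMost_atLeast0 mult.assoc)
    also have "\<dots> = P 1 n / P q n" unfolding q_Vandermonde CC ..
    also have "\<dots> = fps_nth (1 :: complex fps) n" by (cases n) (simp_all add: qpoch_Suc_shift)
    finally show "fps_nth (V * V') n = fps_nth (1 :: complex fps) n" .
  qed
  have CK: "C' ^ K * C ^ j = C' ^ (K - j)" if "j \<le> K" for j K
  proof -
    have "C' ^ K = C' ^ (K - j) * C' ^ j" using that by (simp flip: power_add)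
    then show ?thesis using CC by (simp add: mult.assoc mult.commute flip: power_mult_distrib)
  qed
  have e1: "(\<Sum>j\<le>K. \<alpha> j * C ^ j * (P C (K - j) / P q (K - j))) * C' ^ K = fps_nth (A * V) K" for K
    unfolding sum_distrib_right fps_mult_nth atMost_atLeast0
    by (intro sum.cong refl) (simp add: A_def V_def CK[symmetric])
  have e2: "(\<Sum>i\<le>M. \<alpha>' i * C' ^ i * (P C' (M - i) / P q (M - i))) = fps_nth (A' * V') M" for M
    by (simp add: fps_mult_nth atMost_atLeast0 A'_def V'_def)
  have e3: "(\<Sum>j\<le>K. \<alpha> j * C ^ j * (P C (K - j) / P q (K - j))) * (C' ^ K * Z) = fps_nth (A * V) K * Z" for K Z
    by (subst mult.assoc[symmetric], subst e1) rule
  have "(\<Sum>K\<le>N. (\<Sum>j\<le>K. \<alpha> j * C ^ j * (P C (K - j) / P q (K - j))) *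
      (C' ^ K * (\<Sum>i\<le>N - K. \<alpha>' i * C' ^ i * (P C' (N - K - i) / P q (N - K - i)))))
    = fps_nth ((A * V) * (A' * V')) N"
    unfolding e3 e2 unfolding fps_mult_nth[of "A * V"] atMost_atLeast0 ..
  also have "(A * V) * (A' * V') = A * A' * (V * V')" by (simp only: ac_simps)
  also have "fps_nth \<dots> N = (\<Sum>j\<le>N. \<alpha> j * (\<alpha>' (N - j) * C' ^ (N - j)))"
    unfolding \<open>V * V' = 1\<close> by (simp add: fps_mult_nth A_def A'_def atMost_atLeast0)
  finally show ?thesis .
qed

lemma W_expansion_scaled:
  fixes t b d d' e :: complex
  assumes nz: "t \<noteq> 0" "b \<noteq> 0" "d \<noteq> 0" "d' \<noteq> 0" "e \<noteq> 0"
    and t1: "P (1 / t) n \<noteq> 0"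
    and den: "W_denom (t * q powi (- int n)) [b, d, d', e * q powi (- int n), q powi (- int n)] q n \<noteq> 0"
    and n: "n \<le> N"
  defines "c \<equiv> q / e"
  defines "C \<equiv> b * d * d' / (t * (c * t))"
  shows "P (c * q ^ n) (N - n) * (P (b / t) n * P (d / t) n * P (d' / t) n / (P q n * P (1 / t) n) *
      basic_W (t * q powi (- int n)) [b, d, d', e * q powi (- int n), q powi (- int n)] q
        (t^2 * q^2 / (b * d * d' * e))) =
    (\<Sum>j\<le>n. P (c * t / b) j * P (c * t / d) j * P (c * t / d') j / (P q j * P (c * t) j)
            * P (c * q ^ j) (N - j) * C ^ j * (P C (n - j) / P q (n - j)))"
proof -
  note W = W_conversion[OF nz t1 den, folded c_def]
  have c: "c \<noteq> 0" using nz q_nonzero by (simp add: c_def)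
  have "P (c * q ^ n) (N - n) * P (c * q ^ (n - k)) k = P (c * q ^ (n - k)) (N - (n - k))" if "k \<le> n" for k
  proof -
    have "q ^ n = q ^ (n - k) * q ^ k" using that by (simp flip: power_add)
    moreover have "N - (n - k) = k + (N - n)" using that n by simp
    ultimately show ?thesis by (simp add: qpoch_add ac_simps)
  qed
  then have "P (c * q ^ n) (N - n) *
      (\<Sum>k\<le>n. weight t k (n - k) * (qpoch2 t b k (n - k) * qpoch2 t d k (n - k) * qpoch2 t d' k (n - k))
            * P (c * q ^ (n - k)) k / P (c * t) k) =
      (\<Sum>k\<le>n. weight t k (n - k) * (qpoch2 t b k (n - k) * qpoch2 t d k (n - k) * qpoch2 t d' k (n - k))
            * P (c * q ^ (n - k)) (N - (n - k)) / P (c * t) k)"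
    unfolding sum_distrib_left by (intro sum.cong refl) (simp add: ac_simps)
  then show ?thesis
    unfolding W(3) two_point_transformation_regularized[OF W(1,2) c nz(2-4) n] C_def by simp
qed

lemma W_expansion:
  fixes t b d d' e :: complex
  assumes nz: "t \<noteq> 0" "b \<noteq> 0" "d \<noteq> 0" "d' \<noteq> 0" "e \<noteq> 0"
    and t1: "P (1 / t) n \<noteq> 0"
    and den: "W_denom (t * q powi (- int n)) [b, d, d', e * q powi (- int n), q powi (- int n)] q n \<noteq> 0"
    and e: "P (q / e) n \<noteq> 0"
  defines "c \<equiv> q / e"
  defines "C \<equiv> b * d * d' / (t * (c * t))"
  shows "P (b / t) n * P (d / t) n * P (d' / t) n / (P q n * P (1 / t) n * P c n) *
      basic_W (t * q powi (- int n)) [b, d, d', e * q powi (- int n), q powi (- int n)] q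
        (t^2 * q^2 / (b * d * d' * e)) =
    (\<Sum>j\<le>n. P (c * t / b) j * P (c * t / d) j * P (c * t / d') j / (P q j * P (c * t) j * P c j)
            * C ^ j * (P C (n - j) / P q (n - j)))"
proof -
  have "P (c * q ^ j) (n - j) = P c n / P c j" if "j \<le> n" for j
    using qpoch_split[OF that, of c q] qpoch_nonzero_le[OF e that] by (simp add: c_def)
  then have "(\<Sum>j\<le>n. P (c * t / b) j * P (c * t / d) j * P (c * t / d') j / (P q j * P (c * t) j)
            * P (c * q ^ j) (n - j) * C ^ j * (P C (n - j) / P q (n - j))) / P c n = 
     (\<Sum>j\<le>n. P (c * t / b) j * P (c * t / d) j * P (c * t / d') j / (P q j * P (c * t) j)
            * (1 / P c j) * C ^ j * (P C (n - j) / P q (n - j)))"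
    unfolding sum_divide_distrib using e by (intro sum.cong refl) (simp add: c_def ac_simps)
  then show ?thesis
    unfolding W_expansion_scaled[OF nz t1 den order_refl, folded c_def, folded C_def, symmetric]
    by (simp add: ac_simps)
qed

text \<open>
The one place where the power of \<open>q\<close> does not cancel is the prefactor of the final formula.
\<close>

lemma reversal_factor_square: "reversal_factor n n * reversal_factor n n = (q / q ^ n) ^ n"
proof -
  have "reversal_factor n n = (\<Prod>i<n. q ^ Suc (n - Suc i) / q ^ n)"
    unfolding reversal_factor_def by (rule prod.nat_diff_reindex[symmetric])
  also have "\<dots> = (\<Prod>i<n. 1 / q ^ i)"
  proof (intro prod.cong refl)
    fix i assume "i \<in> {..<n}"
    then have "q ^ n = q ^ Suc (n - Suc i) * q ^ i"
      by (simp del: power_Suc flip: power_add)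
    then show "q ^ Suc (n - Suc i) / q ^ n = 1 / q ^ i"
      using q_nonzero by simp
  qed
  finally have "reversal_factor n n * reversal_factor n n = (\<Prod>i<n. (q ^ Suc i / q ^ n) * (1 / q ^ i))"
    unfolding prod.distrib by (simp add: reversal_factor_def)
  also have "\<dots> = (\<Prod>i<n. q / q ^ n)"
    using q_nonzero by (intro prod.cong) auto
  finally show ?thesis by simp
qed

lemma outer_cancellation:
  fixes th :: complex
  assumes "th \<noteq> 0" "B \<noteq> 0" "D \<noteq> 0" "D' \<noteq> 0" "B' \<noteq> 0" "G \<noteq> 0" "G' \<noteq> 0" "U' \<noteq> 0" "Q' \<noteq> 0"
    and y: "y1 \<noteq> 0" "y2 \<noteq> 0" "y3 \<noteq> 0"
    and pow: "x1 * x2 * x3 * u = y1 * y2 * y3 * v"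
  shows "(x1 * th * U) * ((x2 * th * F) * (x3 * th * Q)) / ((y1 * th * B) * ((y2 * th * D) * (y3 * th * G))) * u
    = ((U' * U) * (Q' * Q) / ((B' * B) * (D' * D) * (G' * G))) * v * (F * (B' * D' * G' / (Q' * U')))"
proof -
  have "(x1 * th * U) * ((x2 * th * F) * (x3 * th * Q)) / ((y1 * th * B) * ((y2 * th * D) * (y3 * th * G))) * u
    = (x1 * x2 * x3 * u) / (y1 * y2 * y3) * (U * F * Q / (B * D * G))"
    using assms(1-12) by (simp add: field_simps)
  also have "\<dots> = ((U' * U) * (Q' * Q) / ((B' * B) * (D' * D) * (G' * G))) * v * (F * (B' * D' * G' / (Q' * U')))"
    unfolding pow using assms(1-12) by (simp add: field_simps)
  finally show ?thesis .
qed

text \<open>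
The part of the outer summand that belongs to the second very well-poised series, rewritten as
the normalization which \<open>W_expansion_scaled\<close> expects at \<open>n = N - K\<close>, times \<open>C\<^sup>K\<close> and a constant.
\<close>

lemma outer_factor_reverse:
  fixes \<sigma> \<beta> \<delta> \<delta>' \<phi> :: complex
  assumes nz: "\<sigma> \<noteq> 0" "\<beta> \<noteq> 0" "\<delta> \<noteq> 0" "\<delta>' \<noteq> 0" "\<phi> \<noteq> 0"
    and K: "K \<le> N"
  defines "s \<equiv> \<sigma> * q ^ N"
  defines "c \<equiv> q / (\<phi> * q ^ N)"
  defines "C \<equiv> \<beta> * \<delta> * \<delta>' / (s * (c * s))"
  assumes den: "P (\<beta> / s) N \<noteq> 0" "P (\<delta> / s) N \<noteq> 0" "P (\<delta>' / s) N \<noteq> 0" "P (1 / s) N \<noteq> 0"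
  shows "P (\<sigma> * q) K * (P \<phi> K * P (1 / q ^ N) K) /
       (P (\<sigma> * q / \<beta>) K * (P (\<sigma> * q / \<delta>) K * P (\<sigma> * q / \<delta>') K)) * q ^ K =
     P (1 / s) N * P q N / (P (\<beta> / s) N * P (\<delta> / s) N * P (\<delta>' / s) N) * C ^ K *
     (P (c * q ^ (N - K)) K *
       (P (\<beta> / s) (N - K) * P (\<delta> / s) (N - K) * P (\<delta>' / s) (N - K) / (P q (N - K) * P (1 / s) (N - K))))"
proof -
  have s: "s \<noteq> 0" and c: "c \<noteq> 0" using nz q_nonzero by (simp_all add: s_def c_def)
  have rev: "P (\<sigma> * q / x) K = (- s / x) ^ K * reversal_factor N K * P (x / s * q ^ (N - K)) K" if "x \<noteq> 0" for x
    using qpoch_reverse[of "x / s" K N] that s K q_nonzero by (simp add: s_def ac_simps)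
  have rev1: "P (\<sigma> * q) K = (- s) ^ K * reversal_factor N K * P (1 / s * q ^ (N - K)) K"
    using rev[of 1] by simp
  have revc: "P \<phi> K = (- 1 / c) ^ K * reversal_factor N K * P (c * q ^ (N - K)) K"
    using qpoch_reverse[of c K N] c K q_nonzero nz by (simp add: c_def)
  have revq: "P (1 / q ^ N) K = (- 1 / q) ^ K * reversal_factor N K * P (q * q ^ (N - K)) K"
    using qpoch_reverse[of q K N] K q_nonzero by simp
  have split: "P x N = P x (N - K) * P (x * q ^ (N - K)) K" for x
    using qpoch_split[of "N - K" N x q] K by simp
  have pow: "(- s) ^ K * (- 1 / c) ^ K * (- 1 / q) ^ K * q ^ K =
      (- s / \<beta>) ^ K * (- s / \<delta>) ^ K * (- s / \<delta>') ^ K * C ^ K"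
    unfolding power_mult_distrib[symmetric] C_def
    using nz q_nonzero s c by (simp add: field_simps)
  show ?thesis
    unfolding rev[OF nz(2)] rev[OF nz(3)] rev[OF nz(4)] rev1 revc revq split
    by (rule outer_cancellation[OF reversal_factor_nonzero _ _ _ _ _ _ _ _ _ _ _ pow])
       (use den[unfolded split] P_q_nonzero[of N, unfolded split] s nz in auto)
qed

lemma prefactor_reverse:
  fixes \<sigma> \<beta> \<delta> \<delta>' \<phi> :: complex and N :: nat
  assumes nz: "\<sigma> \<noteq> 0" "\<beta> \<noteq> 0" "\<delta> \<noteq> 0" "\<delta>' \<noteq> 0" "\<phi> \<noteq> 0"
  defines "s \<equiv> \<sigma> * q ^ N"
  defines "c \<equiv> q / (\<phi> * q ^ N)"
  defines "C \<equiv> \<beta> * \<delta> * \<delta>' / (s * (c * s))"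
  shows "\<phi> ^ N * (P (\<sigma> * q) N / (P (\<sigma> * q / \<beta>) N * P (\<sigma> * q / \<delta>) N * P (\<sigma> * q / \<delta>') N)) =
    C ^ N * (P (1 / s) N / (P (\<beta> / s) N * P (\<delta> / s) N * P (\<delta>' / s) N))"
proof -
  have s: "s \<noteq> 0" and c: "c \<noteq> 0" using nz q_nonzero by (simp_all add: s_def c_def)
  define th where "th = reversal_factor N N"
  have th: "th \<noteq> 0" using reversal_factor_nonzero by (simp add: th_def)
  have rev: "P (\<sigma> * q / x) N = (- s / x) ^ N * th * P (x / s) N" if "x \<noteq> 0" for x
    using qpoch_reverse[of "x / s" N N] that s q_nonzero by (simp add: s_def th_def ac_simps)
  have rev1: "P (\<sigma> * q) N = (- s) ^ N * th * P (1 / s) N"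
    using rev[of 1] by simp
  have "\<phi> ^ N * (- s) ^ N = (- s / \<beta>) ^ N * (- s / \<delta>) ^ N * (- s / \<delta>') ^ N * C ^ N * (q / q ^ N) ^ N"
    unfolding power_mult_distrib[symmetric] C_def c_def
    using nz q_nonzero s by (simp add: field_simps)
  then have pow: "\<phi> ^ N * (- s) ^ N = (- s / \<beta>) ^ N * (- s / \<delta>) ^ N * (- s / \<delta>') ^ N * C ^ N * (th * th)"
    unfolding th_def reversal_factor_square .
  have alg: "f * (x * th * U / (y1 * th * B * (y2 * th * D) * (y3 * th * G))) = v * (U / (B * D * G))"
    if "f * x = y1 * y2 * y3 * v * (th * th)" "y1 \<noteq> 0" "y2 \<noteq> 0" "y3 \<noteq> 0"
    for f x U y1 y2 y3 v B D G :: complex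
  proof -
    have "f * (x * th * U / (y1 * th * B * (y2 * th * D) * (y3 * th * G))) =
       (f * x) / (y1 * y2 * y3 * (th * th)) * (U / (B * D * G))"
      using th that(2-4) by (simp add: field_simps)
    then show ?thesis unfolding that(1) using th that(2-4) by simp
  qed
  show ?thesis
    unfolding rev[OF nz(2)] rev[OF nz(3)] rev[OF nz(4)] rev1
    by (rule alg[OF pow]) (use s nz in auto)
qed

text \<open>
Reading the coefficient \<open>\<alpha>'\<^bsub>N-j\<^esub>\<close> backwards turns it into the \<open>j\<close>-th term of the \<open>\<^sub>6\<phi>\<^sub>5\<close>. The
products \<open>(\<phi>)\<^sub>j\<close> and \<open>(c q\<^bsup>N-j\<^esup>)\<^sub>j\<close> vanish together, so no division by either occurs.
\<close>

lemma coefficient_reverse: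
  fixes \<sigma> \<beta> \<delta> \<delta>' \<phi> :: complex
  assumes nz: "\<sigma> \<noteq> 0" "\<beta> \<noteq> 0" "\<delta> \<noteq> 0" "\<delta>' \<noteq> 0" "\<phi> \<noteq> 0"
    and j: "j \<le> N"
  defines "s \<equiv> \<sigma> * q ^ N"
  defines "c \<equiv> q / (\<phi> * q ^ N)"
  defines "C \<equiv> \<beta> * \<delta> * \<delta>' / (s * (c * s))"
  assumes den: "P (\<sigma> * q / \<phi>) N \<noteq> 0" "P (\<beta> * \<phi> / (\<sigma> * q ^ N)) j \<noteq> 0"
    "P (\<delta> * \<phi> / (\<sigma> * q ^ N)) j \<noteq> 0" "P (\<delta>' * \<phi> / (\<sigma> * q ^ N)) j \<noteq> 0"
  shows "P q N * (P (c * s / \<beta>) (N - j) * P (c * s / \<delta>) (N - j) * P (c * s / \<delta>') (N - j) /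
       (P q (N - j) * P (c * s) (N - j)) * P (c * q ^ (N - j)) j * C ^ (N - j)) =
     C ^ N * (P (\<sigma> * q / (\<beta> * \<phi>)) N * P (\<sigma> * q / (\<delta> * \<phi>)) N * P (\<sigma> * q / (\<delta>' * \<phi>)) N / P (\<sigma> * q / \<phi>) N) *
      (P (\<phi> / (\<sigma> * q ^ N)) j * (P \<phi> j * P (1 / q ^ N) j) /
       (P (\<beta> * \<phi> / (\<sigma> * q ^ N)) j * (P (\<delta> * \<phi> / (\<sigma> * q ^ N)) j * P (\<delta>' * \<phi> / (\<sigma> * q ^ N)) j)) * q ^ j)"
proof -
  have s: "s \<noteq> 0" and c: "c \<noteq> 0" using nz q_nonzero by (simp_all add: s_def c_def)
  have cs: "c * s = \<sigma> * q / \<phi>" using nz q_nonzero by (simp add: s_def c_def)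
  define X where "X x = \<sigma> * q / (x * \<phi>)" for x
  have csx: "c * s / x = X x" for x by (simp add: cs X_def)
  have X: "X x \<noteq> 0" if "x \<noteq> 0" for x using that nz q_nonzero by (simp add: X_def)
  have X1: "\<sigma> * q / \<phi> = X 1" by (simp add: X_def)
  define th where "th = reversal_factor N j"
  have th: "th \<noteq> 0" using reversal_factor_nonzero by (simp add: th_def)
  have rev: "P (x * \<phi> / (\<sigma> * q ^ N)) j = (- 1 / X x) ^ j * th * P (X x * q ^ (N - j)) j" if "x \<noteq> 0" for x
    using qpoch_reverse[OF X[OF that] j] that nz q_nonzero by (simp add: X_def th_def ac_simps)
  have rev1: "P (\<phi> / (\<sigma> * q ^ N)) j = (- 1 / X 1) ^ j * th * P (X 1 * q ^ (N - j)) j"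
    using rev[of 1] by simp
  have revc: "P \<phi> j = (- 1 / c) ^ j * th * P (c * q ^ (N - j)) j"
    using qpoch_reverse[OF c j] q_nonzero nz by (simp add: c_def th_def)
  have revq: "P (1 / q ^ N) j = (- 1 / q) ^ j * th * P (q * q ^ (N - j)) j"
    using qpoch_reverse[of q j N] j q_nonzero by (simp add: th_def)
  have split: "P x N = P x (N - j) * P (x * q ^ (N - j)) j" for x
    using qpoch_split[of "N - j" N x q] j by simp
  have CN: "C ^ N = C ^ (N - j) * C ^ j"
    using j by (simp flip: power_add)
  have pow: "C ^ j * ((- 1 / X 1) ^ j * (- 1 / c) ^ j * (- 1 / q) ^ j) * q ^ j =
      (- 1 / X \<beta>) ^ j * (- 1 / X \<delta>) ^ j * (- 1 / X \<delta>') ^ j"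
    unfolding power_mult_distrib[symmetric] C_def cs X_def
    using nz q_nonzero s c by (simp add: field_simps) (simp add: c_def s_def ac_simps)
  have alg: "(Q' * Q) * (B' * D' * G' / (Q' * L') * F * v) =
      (v * v') * ((B' * B) * (D' * D) * (G' * G) / (L' * L)) *
      ((x1 * th * L) * ((x2 * th * F) * (x3 * th * Q)) / ((y1 * th * B) * ((y2 * th * D) * (y3 * th * G))) * u)"
    if "v' * (x1 * x2 * x3) * u = y1 * y2 * y3" "y1 \<noteq> 0" "y2 \<noteq> 0" "y3 \<noteq> 0"
      "B \<noteq> 0" "D \<noteq> 0" "G \<noteq> 0" "L \<noteq> 0" "Q' \<noteq> 0"
    for Q' Q B' D' G' L' L F v v' x1 x2 x3 y1 y2 y3 B D G u :: complex
  proof -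
    have "(v * v') * ((B' * B) * (D' * D) * (G' * G) / (L' * L)) *
      ((x1 * th * L) * ((x2 * th * F) * (x3 * th * Q)) / ((y1 * th * B) * ((y2 * th * D) * (y3 * th * G))) * u)
      = (v' * (x1 * x2 * x3) * u) / (y1 * y2 * y3) * (v * B' * D' * G' * F * Q / L')"
      using th that(2-) by (simp add: ac_simps)
    then show ?thesis unfolding that(1) using that(2-) by simp
  qed
  show ?thesis
    unfolding csx unfolding cs X1 X_def[symmetric] CN rev[OF nz(2)] rev[OF nz(3)] rev[OF nz(4)] rev1 revc revq split
    by (rule alg[OF pow])
       (use den X nz th P_q_nonzero[of N, unfolded split] in \<open>auto simp: X1 split rev\<close>)
qed

end

lemma q_base_norm:
  assumes "0 < norm q" "norm q < 1"
  shows "q_base q"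
proof
  show "q \<noteq> 0" using assms by auto
  fix n :: nat assume "0 < n"
  then have "norm (q ^ n) < 1"
    using assms power_less_one_iff[of "norm q" n] by (simp add: norm_power)
  then show "q ^ n \<noteq> 1" by auto
qed

section \<open>The bilinear identity\<close>

theorem mainTheorem4:
  fixes q t b d1 d2 e \<sigma> \<beta> \<delta>1 \<delta>2 \<phi> :: complex and N :: nat
  assumes q: "0 < norm q" "norm q < 1"
    and nonzero: "t \<noteq> 0" "b \<noteq> 0" "d1 \<noteq> 0" "d2 \<noteq> 0" "e \<noteq> 0"
      "\<sigma> \<noteq> 0" "\<beta> \<noteq> 0" "\<delta>1 \<noteq> 0" "\<delta>2 \<noteq> 0" "\<phi> \<noteq> 0"
    and balanced: "t^2 * \<sigma>^2 * q^(N + 2) = b * d1 * d2 * e * \<beta> * \<delta>1 * \<delta>2 * \<phi>"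
    and denom_outer: "\<And>K. K \<le> N \<Longrightarrow>
      qpochs [q, 1/t, q/e, \<sigma>*q/\<beta>, \<sigma>*q/\<delta>1, \<sigma>*q/\<delta>2] q K \<noteq> 0"
    and denom_W1: "\<And>K k. K \<le> N \<Longrightarrow> k \<le> K \<Longrightarrow>
      W_denom (t * q powi (- int K))
        [b, d1, d2, e * q powi (- int K), q powi (- int K)] q k \<noteq> 0"
    and denom_W2: "\<And>K k. K \<le> N \<Longrightarrow> k \<le> N - K \<Longrightarrow>
      W_denom (\<sigma> * q^K) [\<beta>, \<delta>1, \<delta>2, \<phi> * q^K, q powi (int K - int N)] q k \<noteq> 0"
    and denom_prefactor: "qpochs [\<sigma>*q/\<beta>, \<sigma>*q/\<phi>, \<sigma>*q/\<delta>1, \<sigma>*q/\<delta>2] q N \<noteq> 0"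
    and denom_phi: "\<And>k. k \<le> N \<Longrightarrow>
      phi_denom [t*q/e, q/e, q powi (- int N) * \<beta> * \<phi> / \<sigma>,
        q powi (- int N) * \<delta>1 * \<phi> / \<sigma>, q powi (- int N) * \<delta>2 * \<phi> / \<sigma>] q k \<noteq> 0"
  shows
    "(\<Sum>K\<le>N.
        qpochs [b/t, d1/t, d2/t, \<sigma>*q, \<phi>, q powi (- int N)] q K /
        qpochs [q, 1/t, q/e, \<sigma>*q/\<beta>, \<sigma>*q/\<delta>1, \<sigma>*q/\<delta>2] q K * q^K *
        basic_W (t * q powi (- int K))
          [b, d1, d2, e * q powi (- int K), q powi (- int K)] q
          (t^2 * q^2 / (b * d1 * d2 * e)) *
        basic_W (\<sigma> * q^K)
          [\<beta>, \<delta>1, \<delta>2, \<phi> * q^K, q powi (int K - int N)] q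
          (\<sigma>^2 * q^(N + 2) / (\<beta> * \<delta>1 * \<delta>2 * \<phi>)))
     = \<phi>^N *
       (qpochs [\<sigma>*q, \<sigma>*q/(\<beta>*\<phi>), \<sigma>*q/(\<delta>1*\<phi>), \<sigma>*q/(\<delta>2*\<phi>)] q N /
        qpochs [\<sigma>*q/\<beta>, \<sigma>*q/\<phi>, \<sigma>*q/\<delta>1, \<sigma>*q/\<delta>2] q N) *
       basic_phi
         [t*q/(b*e), t*q/(d1*e), t*q/(d2*e), q powi (- int N) * \<phi> / \<sigma>, \<phi>, q powi (- int N)]
         [t*q/e, q/e, q powi (- int N) * \<beta> * \<phi> / \<sigma>,
          q powi (- int N) * \<delta>1 * \<phi> / \<sigma>, q powi (- int N) * \<delta>2 * \<phi> / \<sigma>] q q"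
proof -
  interpret q_base q
    using q by (rule q_base_norm)
  define s where "s = \<sigma> * q ^ N"
  define \<epsilon> where "\<epsilon> = \<phi> * q ^ N"
  define c where "c = q / e"
  define c' where "c' = q / \<epsilon>"
  define C where "C = b * d1 * d2 / (t * (c * t))"
  define C' where "C' = \<beta> * \<delta>1 * \<delta>2 / (s * (c' * s))"
  define \<alpha> where "\<alpha> j = P (c * t / b) j * P (c * t / d1) j * P (c * t / d2) j / (P q j * P (c * t) j * P c j)" for j
  define \<alpha>' where "\<alpha>' i = P (c' * s / \<beta>) i * P (c' * s / \<delta>1) i * P (c' * s / \<delta>2) i / (P q i * P (c' * s) i) *
      P (c' * q ^ i) (N - i)" for i
  define \<kappa> where "\<kappa> = P (1 / s) N * P q N / (P (\<beta> / s) N * P (\<delta>1 / s) N * P (\<delta>2 / s) N)"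
  have s: "s \<noteq> 0" and \<epsilon>: "\<epsilon> \<noteq> 0" using nonzero q_nonzero by (simp_all add: s_def \<epsilon>_def)
  have powi: "q powi (int K - int N) = q powi (- int (N - K))"
    and shift: "\<sigma> * q ^ K = s * q powi (- int (N - K))" "\<phi> * q ^ K = \<epsilon> * q powi (- int (N - K))"
    if "K \<le> N" for K
  proof -
    have "q ^ N = q ^ K * q ^ (N - K)" using that by (simp flip: power_add)
    then show "\<sigma> * q ^ K = s * q powi (- int (N - K))" "\<phi> * q ^ K = \<epsilon> * q powi (- int (N - K))"
      using q_nonzero by (simp_all add: powi_minus s_def \<epsilon>_def)
    show "q powi (int K - int N) = q powi (- int (N - K))"
      using that by (simp add: of_nat_diff)
  qed
  have "C * C' = b * d1 * d2 * e * \<beta> * \<delta>1 * \<delta>2 * \<phi> / (t^2 * \<sigma>^2 * q^(N + 2))"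
    unfolding C_def C'_def c_def c'_def s_def \<epsilon>_def using nonzero q_nonzero
    by (simp add: field_simps power2_eq_square)
  then have CC: "C * C' = 1"
    unfolding balanced[symmetric] using nonzero q_nonzero by simp
  have outer: "P q K \<noteq> 0" "P (1 / t) K \<noteq> 0" "P (q / e) K \<noteq> 0"
     "P (\<sigma> * q / \<beta>) K \<noteq> 0" "P (\<sigma> * q / \<delta>1) K \<noteq> 0" "P (\<sigma> * q / \<delta>2) K \<noteq> 0" if "K \<le> N" for K
    using denom_outer[OF that] by (auto simp: qpochs_def)
  have rev: "P (x / s) N \<noteq> 0" if "P (\<sigma> * q / x) N \<noteq> 0" "x \<noteq> 0" for x
    using qpoch_reverse[of "x / s" N N] that s q_nonzero by (auto simp: s_def ac_simps)
  \<comment> \<open>The factors are \<open>1 - 1 / (\<sigma> q\<^bsup>N-i\<^esup>)\<close>, and \<open>1 - \<sigma> q\<^bsup>N-i\<^esup>\<close> is part of a denominator of the second series.\<close>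
  have P_s: "P (1 / s) N \<noteq> 0"
  proof -
    have "1 - 1 / s * q ^ i \<noteq> 0" if "i < N" for i
    proof -
      have "1 - \<sigma> * q ^ (N - i) \<noteq> 0"
        using denom_W2[of "N - i" 0] by (auto simp: W_denom_def)
      moreover have "q ^ N = q ^ (N - i) * q ^ i" using that by (simp flip: power_add)
      ultimately show ?thesis using nonzero q_nonzero by (simp add: s_def field_simps)
    qed
    then show ?thesis using s by (auto simp: qpoch_def)
  qed
  have W1: "P (b / t) K * P (d1 / t) K * P (d2 / t) K / (P q K * P (1 / t) K * P c K) *
      basic_W (t * q powi (- int K)) [b, d1, d2, e * q powi (- int K), q powi (- int K)] q
        (t^2 * q^2 / (b * d1 * d2 * e)) =
    (\<Sum>j\<le>K. \<alpha> j * C ^ j * (P C (K - j) / P q (K - j)))" if "K \<le> N" for K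
    using W_expansion[OF nonzero(1-5) outer(2)[OF that] denom_W1[OF that order_refl] outer(3)[OF that]]
    unfolding \<alpha>_def C_def c_def .
  have W2: "P (c' * q ^ (N - K)) K * (P (\<beta> / s) (N - K) * P (\<delta>1 / s) (N - K) * P (\<delta>2 / s) (N - K) /
        (P q (N - K) * P (1 / s) (N - K)) *
      basic_W (\<sigma> * q ^ K) [\<beta>, \<delta>1, \<delta>2, \<phi> * q ^ K, q powi (int K - int N)] q
        (\<sigma>^2 * q^(N + 2) / (\<beta> * \<delta>1 * \<delta>2 * \<phi>))) =
    (\<Sum>i\<le>N - K. \<alpha>' i * C' ^ i * (P C' (N - K - i) / P q (N - K - i)))" if K: "K \<le> N" for K
  proof -
    have arg: "\<sigma>^2 * q^(N + 2) / (\<beta> * \<delta>1 * \<delta>2 * \<phi>) = s^2 * q^2 / (\<beta> * \<delta>1 * \<delta>2 * \<epsilon>)"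
      using nonzero q_nonzero by (simp add: s_def \<epsilon>_def field_simps power2_eq_square)
    have den: "W_denom (s * q powi (- int (N - K)))
        [\<beta>, \<delta>1, \<delta>2, \<epsilon> * q powi (- int (N - K)), q powi (- int (N - K))] q (N - K) \<noteq> 0"
      using denom_W2[OF K order_refl] unfolding powi[OF K] shift[OF K] .
    have P1: "P (1 / s) (N - K) \<noteq> 0"
      using P_s by (rule qpoch_nonzero_le) simp
    have NK: "N - (N - K) = K" using K by simp
    show ?thesis
      using W_expansion_scaled[OF s nonzero(7-9) \<epsilon> P1 den, of N]
      unfolding powi[OF K] shift[OF K] arg \<alpha>'_def C'_def c'_def NK by simp
  qed
  have summand: "qpochs [b/t, d1/t, d2/t, \<sigma>*q, \<phi>, q powi (- int N)] q K /
        qpochs [q, 1/t, q/e, \<sigma>*q/\<beta>, \<sigma>*q/\<delta>1, \<sigma>*q/\<delta>2] q K * q^K *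
        basic_W (t * q powi (- int K)) [b, d1, d2, e * q powi (- int K), q powi (- int K)] q
          (t^2 * q^2 / (b * d1 * d2 * e)) *
        basic_W (\<sigma> * q^K) [\<beta>, \<delta>1, \<delta>2, \<phi> * q^K, q powi (int K - int N)] q
          (\<sigma>^2 * q^(N + 2) / (\<beta> * \<delta>1 * \<delta>2 * \<phi>)) =
     \<kappa> * ((\<Sum>j\<le>K. \<alpha> j * C ^ j * (P C (K - j) / P q (K - j))) *
       (C' ^ K * (\<Sum>i\<le>N - K. \<alpha>' i * C' ^ i * (P C' (N - K - i) / P q (N - K - i)))))"
    (is "?n / ?d * q ^ K * ?W * ?W' = _") if K: "K \<le> N" for K
  proof -
    have "?n / ?d * q ^ K * ?W * ?W' = P (b / t) K * P (d1 / t) K * P (d2 / t) K / (P q K * P (1 / t) K * P c K) * ?W *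
      (P (\<sigma> * q) K * (P \<phi> K * P (1 / q ^ N) K) /
       (P (\<sigma> * q / \<beta>) K * (P (\<sigma> * q / \<delta>1) K * P (\<sigma> * q / \<delta>2) K)) * q ^ K * ?W')"
      by (simp add: qpochs_def powi_minus c_def ac_simps)
    also have "P (\<sigma> * q) K * (P \<phi> K * P (1 / q ^ N) K) /
       (P (\<sigma> * q / \<beta>) K * (P (\<sigma> * q / \<delta>1) K * P (\<sigma> * q / \<delta>2) K)) * q ^ K =
       \<kappa> * C' ^ K * (P (c' * q ^ (N - K)) K *
       (P (\<beta> / s) (N - K) * P (\<delta>1 / s) (N - K) * P (\<delta>2 / s) (N - K) / (P q (N - K) * P (1 / s) (N - K))))"
      unfolding \<kappa>_def C'_def c'_def s_def \<epsilon>_def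
      by (rule outer_factor_reverse[OF nonzero(6-10) K])
         (use rev[unfolded s_def] outer[of N] nonzero P_s[unfolded s_def] in auto)
    finally show ?thesis
      unfolding W1[OF K, symmetric] W2[OF K, symmetric] by (simp only: ac_simps)
  qed
  have coefficient: "\<kappa> * (\<alpha> j * (\<alpha>' (N - j) * C' ^ (N - j))) =
      \<phi>^N * (qpochs [\<sigma>*q, \<sigma>*q/(\<beta>*\<phi>), \<sigma>*q/(\<delta>1*\<phi>), \<sigma>*q/(\<delta>2*\<phi>)] q N /
        qpochs [\<sigma>*q/\<beta>, \<sigma>*q/\<phi>, \<sigma>*q/\<delta>1, \<sigma>*q/\<delta>2] q N) *
      (qpochs [t*q/(b*e), t*q/(d1*e), t*q/(d2*e), q powi (- int N) * \<phi> / \<sigma>, \<phi>, q powi (- int N)] q j /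
       phi_denom [t*q/e, q/e, q powi (- int N) * \<beta> * \<phi> / \<sigma>,
          q powi (- int N) * \<delta>1 * \<phi> / \<sigma>, q powi (- int N) * \<delta>2 * \<phi> / \<sigma>] q j * q ^ j)" if j: "j \<le> N" for j
  proof -
    have ct: "c * t = t * q / e" "t * q / e / b = t*q/(b*e)" "t * q / e / d1 = t*q/(d1*e)" "t * q / e / d2 = t*q/(d2*e)"
      by (simp_all add: c_def)
    have pw: "q powi (- int N) * \<phi> / \<sigma> = \<phi> / (\<sigma> * q ^ N)"
      "q powi (- int N) * x * \<phi> / \<sigma> = x * \<phi> / (\<sigma> * q ^ N)" for x
      by (simp_all add: powi_minus)
    have den: "P (\<beta> * \<phi> / (\<sigma> * q ^ N)) j \<noteq> 0" "P (\<delta>1 * \<phi> / (\<sigma> * q ^ N)) j \<noteq> 0" "P (\<delta>2 * \<phi> / (\<sigma> * q ^ N)) j \<noteq> 0"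
      "P (\<sigma> * q / \<phi>) N \<noteq> 0"
      using denom_phi[OF j] denom_prefactor unfolding pw by (auto simp: phi_denom_def qpochs_def)
    note coeff = coefficient_reverse[OF nonzero(6-10) j den(4,1-3), folded s_def, folded \<epsilon>_def, folded c'_def, folded C'_def]
    note pref = prefactor_reverse[OF nonzero(6-10), of N, folded s_def, folded \<epsilon>_def, folded c'_def, folded C'_def]
    have Nj: "N - (N - j) = j" using j by simp
    have "\<kappa> * (\<alpha> j * (\<alpha>' (N - j) * C' ^ (N - j))) =
      \<alpha> j * (P (1 / s) N / (P (\<beta> / s) N * P (\<delta>1 / s) N * P (\<delta>2 / s) N)) *
      (P q N * (P (c' * s / \<beta>) (N - j) * P (c' * s / \<delta>1) (N - j) * P (c' * s / \<delta>2) (N - j) /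
       (P q (N - j) * P (c' * s) (N - j)) * P (c' * q ^ (N - j)) j * C' ^ (N - j)))"
      unfolding \<kappa>_def \<alpha>'_def Nj by (simp add: ac_simps)
    also have "\<dots> = \<alpha> j * (C' ^ N * (P (1 / s) N / (P (\<beta> / s) N * P (\<delta>1 / s) N * P (\<delta>2 / s) N))) *
      ((P (\<sigma> * q / (\<beta> * \<phi>)) N * P (\<sigma> * q / (\<delta>1 * \<phi>)) N * P (\<sigma> * q / (\<delta>2 * \<phi>)) N / P (\<sigma> * q / \<phi>) N) *
      (P (\<phi> / (\<sigma> * q ^ N)) j * (P \<phi> j * P (1 / q ^ N) j) /
       (P (\<beta> * \<phi> / (\<sigma> * q ^ N)) j * (P (\<delta>1 * \<phi> / (\<sigma> * q ^ N)) j * P (\<delta>2 * \<phi> / (\<sigma> * q ^ N)) j)) * q ^ j))"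
      unfolding coeff unfolding s_def[symmetric] by (simp only: ac_simps)
    also note pref[symmetric]
    finally show ?thesis
      unfolding pw \<alpha>_def ct phi_denom_def qpochs_def powi_minus by (simp add: c_def ac_simps)
  qed
  have sum_eq: "(\<Sum>K\<le>N. f K) = \<kappa> * (\<Sum>j\<le>N. \<alpha> j * (\<alpha>' (N - j) * C' ^ (N - j)))"
    if "\<And>K. K \<le> N \<Longrightarrow> f K = \<kappa> * ((\<Sum>j\<le>K. \<alpha> j * C ^ j * (P C (K - j) / P q (K - j))) *
       (C' ^ K * (\<Sum>i\<le>N - K. \<alpha>' i * C' ^ i * (P C' (N - K - i) / P q (N - K - i)))))" for f
    unfolding convolution[OF CC, symmetric] sum_distrib_left[of \<kappa>]
    by (intro sum.cong refl that) simp
  have mem: "q powi (- int N) \<in> set [t*q/(b*e), t*q/(d1*e), t*q/(d2*e), q powi (- int N) * \<phi> / \<sigma>, \<phi>, q powi (- int N)]"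
    by simp
  show ?thesis
    unfolding basic_phi_terminating[OF q_nonzero mem]
  proof (rule trans, rule sum_eq, erule summand, goal_cases)
    case 1
    show ?case
      unfolding sum_distrib_left by (intro sum.cong refl coefficient) simp
  qed
qed

end
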